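(* Let $\boldsymbol{g}=(g_1,\ldots,g_n)'$ be a rate vector of length $n$ and let $\boldsymbol{B}\in\mathbb{R}^{n\times n}$ be an index matrix. Then $\boldsymbol{g}\in R_{\boldsymbol{B}}$ if and only if there exist $a\in(0,\infty)$, $\boldsymbol{v}\in\mathbb{R}^{n\times1}$ and measurable functions $\boldsymbol{\eta},\boldsymbol{\phi}:[a,\infty)\to\mathbb{R}^{n\times1}$, both $o(g_n(t))$ as $t\to\infty$, such that $$\boldsymbol{g}(t)=t^{\boldsymbol{B}}\boldsymbol{v}+\boldsymbol{\eta}(t)+t^{\boldsymbol{B}}\int_a^t u^{-\boldsymbol{B}}\boldsymbol{\phi}(u)\,u^{-1}\,\mathrm{d}u,\qquad t\in[a,\infty).$$
   Context: Limit relations are as $t\to\infty$; measurability is Lebesgue. A real function is defined in a neighbourhood of infinity if its domain contains some $[t_0,\infty)$; it is eventually of constant sign if it is either strictly positive for all large $t$ or strictly negative for all large $t$. A rate vector of length $n$ is a column vector $\boldsymbol{g}=(g_1,\ldots,g_n)'$ of real-valued functions defined in a neighbourhood of infinity, each eventually of constant sign, with $g_{i+1}(t)=o(g_i(t))$ for every $i\in\{1,\ldots,n-1\}$; $o(g_n(t))$ means $o(|g_n(t)|)$, componentwise for vectors. For a square matrix $\boldsymbol{B}$ and $x>0$, $x^{\boldsymbol{B}}=\exp\{(\log x)\boldsymbol{B}\}$. An index matrix is an upper triangular $\boldsymbol{B}\in\mathbb{R}^{n\times n}$ whose diagonal elements are non-increasing and all of whose eigenvalues, except possibly the smallest one, have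 geometric multiplicity one. A rate vector $\boldsymbol{g}$ is regularly varying with index matrix $\boldsymbol{B}$, written $\boldsymbol{g}\in R_{\boldsymbol{B}}$, if $\boldsymbol{g}$ is measurable and $\boldsymbol{g}(xt)=x^{\boldsymbol{B}}\boldsymbol{g}(t)+o(g_n(t))$ for every $x\in(0,\infty)$. In the representation it is understood that the integrals exist (the integrand is integrable on $[a,t]$ for every $t\geq a$). *)

theory Defs
  imports "HOL-Analysis.Analysis" "HOL-Library.Landau_Symbols"
begin

text \<open>
  The coordinates \<open>1, \<dots>, n\<close> are the elements of an arbitrary finite linearly ordered index
  type \<open>'n\<close> with \<open>n = CARD('n)\<close> (every \<open>n \<ge> 1\<close> occurs). The coordinate \<open>i + 1\<close>
  is the immediate successor of \<open>i\<close>, and the last coordinate is the largest index.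

  Functions defined in a neighbourhood of infinity are total functions on the reals whose values
  matter only for large arguments.
\<close>

definition last_index :: "'n::{finite,linorder}" where
  "last_index = Max UNIV"

definition eventually_constant_sign :: "(real \<Rightarrow> real) \<Rightarrow> bool" where
  "eventually_constant_sign f \<longleftrightarrow>
     (\<forall>\<^sub>F t in at_top. f t > 0) \<or> (\<forall>\<^sub>F t in at_top. f t < 0)"

definition rate_vector :: "(real \<Rightarrow> real ^ ('n::{finite,linorder})) \<Rightarrow> bool" where
  "rate_vector g \<longleftrightarrow>
     (\<forall>i. eventually_constant_sign (\<lambda>t. g t $ i)) \<and>
     (\<forall>i j. i < j \<and> {i<..<j} = {} \<longrightarrow> (\<lambda>t. g t $ j) \<in> o[at_top](\<lambda>t. g t $ i))"

text \<open>The relation \<open>h(t) = o(g\<^sub>n(t))\<close> for a vector-valued \<open>h\<close>, componentwise.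
  Membership in \<open>o[at_top]\<close> depends only on absolute values, so \<open>g\<^sub>n\<close> may be negative.\<close>

definition small_o_last ::
  "(real \<Rightarrow> real ^ ('n::{finite,linorder})) \<Rightarrow> (real \<Rightarrow> real ^ ('n::{finite,linorder})) \<Rightarrow> bool" where
  "small_o_last h g \<longleftrightarrow> (\<forall>i. (\<lambda>t. h t $ i) \<in> o[at_top](\<lambda>t. g t $ last_index))"

text \<open>The multiplication of the type class \<open>power\<close> is not available for matrices
  (matrix multiplication is \<open>**\<close>), so powers and the exponential are spelled out.\<close>

primrec matrix_power :: "real ^ 'n ^ 'n \<Rightarrow> nat \<Rightarrow> real ^ 'n ^ 'n" where
  "matrix_power A 0 = mat 1"
| "matrix_power A (Suc k) = A ** matrix_power A k"

definition matrix_exp :: "real ^ 'n ^ 'n \<Rightarrow> real ^ 'n ^ 'n" where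
  "matrix_exp A = (\<Sum>k. matrix_power A k /\<^sub>R fact k)"

definition matrix_powr :: "real \<Rightarrow> real ^ 'n ^ 'n \<Rightarrow> real ^ 'n ^ 'n" where
  "matrix_powr x B = matrix_exp (ln x *\<^sub>R B)"

definition eigenvalue :: "real ^ 'n ^ 'n \<Rightarrow> real \<Rightarrow> bool" where
  "eigenvalue A c \<longleftrightarrow> (\<exists>v. v \<noteq> 0 \<and> A *v v = c *\<^sub>R v)"

definition geometric_multiplicity :: "real ^ 'n ^ 'n \<Rightarrow> real \<Rightarrow> nat" where
  "geometric_multiplicity A c = dim {v. A *v v = c *\<^sub>R v}"

text \<open>Upper triangular real matrices have only real eigenvalues, so real eigenvalues suffice.
  An eigenvalue is not the smallest one iff some eigenvalue lies strictly below it.\<close>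

definition index_matrix :: "real ^ ('n::{finite,linorder}) ^ ('n::{finite,linorder}) \<Rightarrow> bool" where
  "index_matrix B \<longleftrightarrow>
     (\<forall>i j. j < i \<longrightarrow> B $ i $ j = 0) \<and>
     (\<forall>i j. i \<le> j \<longrightarrow> B $ j $ j \<le> B $ i $ i) \<and>
     (\<forall>c. eigenvalue B c \<and> (\<exists>d. eigenvalue B d \<and> d < c) \<longrightarrow> geometric_multiplicity B c = 1)"

text \<open>The set \<open>R\<^sub>B\<close>. As the values of \<open>g\<close> matter only near infinity, Lebesgue
  measurability of \<open>g\<close> is measurability on some half-line \<open>{t\<^sub>0..}\<close>.\<close>

definition regularly_varying ::
  "real ^ ('n::{finite,linorder}) ^ ('n::{finite,linorder}) \<Rightarrow> (real \<Rightarrow> real ^ ('n::{finite,linorder})) set" where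
  "regularly_varying B = {g. rate_vector g \<and>
     (\<exists>t\<^sub>0. g \<in> borel_measurable (lebesgue_on {t\<^sub>0..})) \<and>
     (\<forall>x>0. small_o_last (\<lambda>t. g (x * t) - matrix_powr x B *v g t) g)}"

end

theory Submission
  imports Defs
begin

text \<open>
  If \<open>g\<close> is regularly varying, measurability makes the convergence in
  \<open>g(xt) = x\<^sup>B g(t) + o(g\<^sub>n(t))\<close> uniform for \<open>x\<close> in \<open>[1, 2]\<close>. Put \<open>K(u) = u\<^sup>-\<^sup>B g(u) / u\<close> and replace
  \<open>t\<^sup>-\<^sup>B g(t)\<close> by its mean \<open>(1 / ln 2) \<integral> K\<close> over \<open>[t, 2t]\<close>. By uniformity the error is
  \<open>t\<^sup>-\<^sup>B \<eta>(t)\<close> with \<open>\<eta> = o(g\<^sub>n)\<close>. Splitting the interval, the mean is its value at \<open>t = a\<close> plus the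
  integral over \<open>[a, t]\<close> of \<open>(1 / ln 2) (2 K(2r) - K(r)) = r\<^sup>-\<^sup>B \<phi>(r) / r\<close>, where
  \<open>\<phi>(r) = (1 / ln 2) (2\<^sup>-\<^sup>B g(2r) - g(r)) = o(g\<^sub>n(r))\<close>.

  Conversely, the last coordinate of the representation shows that
  \<open>H(t) = v\<^sub>n + \<integral> u\<^sup>-\<^sup>b \<phi>\<^sub>n(u) du / u\<close> (\<open>b\<close> the last diagonal entry of \<open>B\<close>) is comparable to
  \<open>t\<^sup>-\<^sup>b g\<^sub>n(t)\<close> and has an integrand \<open>o(H(u) / u)\<close>. Hence \<open>H\<close>, and with it \<open>g\<^sub>n\<close>, varies by a bounded
  factor on \<open>[t, Xt]\<close>, so that all error terms in \<open>g(xt) - x\<^sup>B g(t)\<close> are \<open>o(g\<^sub>n(t))\<close>.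
\<close>

section \<open>Matrix exponentials and powers\<close>

lemma sums_vecI:
  fixes f :: "nat \<Rightarrow> 'a::real_normed_vector ^ 'n"
  assumes "\<And>i. (\<lambda>k. f k $ i) sums (S $ i)"
  shows "f sums S"
  using assms unfolding sums_def by (intro vec_tendstoI) simp

text \<open>The operator norm is submultiplicative, and the entry is a coordinate of the power
  applied to \<open>axis j 1\<close>. The bound is geometric in \<open>k\<close>, so each entry of
  the exponential series is dominated by a scalar exponential series.\<close>

lemma matrix_power_entry_bound:
  fixes A :: "real ^ 'n ^ 'n"
  shows "\<bar>matrix_power A k $ i $ j\<bar> \<le> onorm ((*v) A) ^ k"
proof -
  have bl: "bounded_linear ((*v) A)" by (simp add: matrix_vector_mul_bounded_linear)
  have *: "norm (matrix_power A k *v v) \<le> onorm ((*v) A) ^ k * norm v" for v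
  proof (induction k)
    case (Suc k)
    have "norm (matrix_power A (Suc k) *v v) = norm (A *v (matrix_power A k *v v))"
      by (simp add: matrix_vector_mul_assoc)
    also have "\<dots> \<le> onorm ((*v) A) * norm (matrix_power A k *v v)"
      by (rule onorm[OF bl])
    also have "\<dots> \<le> onorm ((*v) A) * (onorm ((*v) A) ^ k * norm v)"
      by (intro mult_left_mono Suc onorm_pos_le[OF bl])
    finally show ?case by (simp add: mult.assoc)
  qed simp
  have "matrix_power A k $ i $ j = (matrix_power A k *v axis j 1) $ i"
    by (simp add: matrix_vector_mult_basis column_def)
  then have "\<bar>matrix_power A k $ i $ j\<bar> \<le> norm (matrix_power A k *v axis j 1)"
    by (metis component_le_norm_cart)
  with *[of "axis j 1"] show ?thesis by simp
qed

lemma matrix_power_scaleR: "matrix_power (t *\<^sub>R A) k = t ^ k *\<^sub>R matrix_power A k"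
  by (induction k) (simp_all add: scalar_matrix_assoc matrix_scalar_ac mult.commute)

lemma matrix_power_commute: "A ** matrix_power A k = matrix_power A k ** A"
  by (induction k) (simp_all add: matrix_mul_assoc)

lemma summable_matrix_power_entry:
  fixes A :: "real ^ 'n ^ 'n"
  shows "summable (\<lambda>k. matrix_power A k $ i $ j / fact k * t ^ k)"
proof (rule summable_comparison_test', rule summable_exp[of "onorm ((*v) A) * \<bar>t\<bar>"])
  fix k
  have "\<bar>matrix_power A k $ i $ j\<bar> * \<bar>t\<bar> ^ k \<le> onorm ((*v) A) ^ k * \<bar>t\<bar> ^ k"
    by (intro mult_right_mono matrix_power_entry_bound) simp
  then show "norm (matrix_power A k $ i $ j / fact k * t ^ k)
      \<le> inverse (fact k) * (onorm ((*v) A) * \<bar>t\<bar>) ^ k"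
    by (simp add: abs_mult power_abs power_mult_distrib divide_simps)
qed

text \<open>Pulling \<open>t ^ k\<close> out of the matrix power turns every entry of the
  exponential into a real power series in \<open>t\<close>, to which the scalar theory of termwise
  operations applies.\<close>

lemma matrix_exp_entry_sums:
  fixes A :: "real ^ 'n ^ 'n"
  shows "(\<lambda>k. matrix_power A k $ i $ j / fact k * t ^ k) sums (matrix_exp (t *\<^sub>R A) $ i $ j)"
proof -
  let ?c = "\<lambda>i j k. matrix_power A k $ i $ j / fact k * t ^ k"
  have "(\<lambda>k. matrix_power (t *\<^sub>R A) k /\<^sub>R fact k) sums (\<chi> i j. \<Sum>k. ?c i j k)"
    using summable_sums[OF summable_matrix_power_entry, of A _ _ t]
    by (intro sums_vecI) (simp add: matrix_power_scaleR divide_inverse mult_ac)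
  then have "matrix_exp (t *\<^sub>R A) = (\<chi> i j. \<Sum>k. ?c i j k)"
    unfolding matrix_exp_def by (rule sums_unique[symmetric])
  then have "matrix_exp (t *\<^sub>R A) $ i $ j = (\<Sum>k. ?c i j k)"
    by (simp only: vec_lambda_beta)
  then show ?thesis
    using summable_sums[OF summable_matrix_power_entry[of A i j t]] by (simp only:)
qed

text \<open>Both products are expanded entrywise into series; their terms agree because
  \<open>A\<close> commutes with its powers.\<close>

lemma matrix_exp_commute:
  fixes A :: "real ^ 'n ^ 'n"
  shows "A ** matrix_exp (t *\<^sub>R A) = matrix_exp (t *\<^sub>R A) ** A"
proof -
  let ?c = "\<lambda>k i j. matrix_power A k $ i $ j / fact k * t ^ k"
  have "(A ** matrix_exp (t *\<^sub>R A)) $ i $ j = (matrix_exp (t *\<^sub>R A) ** A) $ i $ j" for i j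
  proof (rule sums_unique2)
    show "(\<lambda>k. \<Sum>l\<in>UNIV. A $ i $ l * ?c k l j) sums ((A ** matrix_exp (t *\<^sub>R A)) $ i $ j)"
      unfolding matrix_matrix_mult_def vec_lambda_beta
      by (intro sums_sum sums_mult matrix_exp_entry_sums)
    have "(\<lambda>k. \<Sum>l\<in>UNIV. ?c k i l * A $ l $ j) sums ((matrix_exp (t *\<^sub>R A) ** A) $ i $ j)"
      unfolding matrix_matrix_mult_def vec_lambda_beta
      by (intro sums_sum sums_mult2 matrix_exp_entry_sums)
    moreover have "(\<Sum>l\<in>UNIV. ?c k i l * A $ l $ j) = (\<Sum>l\<in>UNIV. A $ i $ l * ?c k l j)" for k
    proof -
      have "(\<Sum>l\<in>UNIV. ?c k i l * A $ l $ j) = (matrix_power A k ** A) $ i $ j / fact k * t ^ k"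
        by (simp add: matrix_matrix_mult_def sum_distrib_left sum_distrib_right sum_divide_distrib mult_ac)
      also have "\<dots> = (\<Sum>l\<in>UNIV. A $ i $ l * ?c k l j)"
        unfolding matrix_power_commute[symmetric]
        by (simp add: matrix_matrix_mult_def sum_distrib_left sum_distrib_right sum_divide_distrib mult_ac)
      finally show ?thesis .
    qed
    ultimately show "(\<lambda>k. \<Sum>l\<in>UNIV. A $ i $ l * ?c k l j) sums ((matrix_exp (t *\<^sub>R A) ** A) $ i $ j)"
      by simp
  qed
  then show ?thesis by (simp add: vec_eq_iff)
qed

lemma has_derivative_matrix_exp_entry:
  fixes A :: "real ^ 'n ^ 'n"
  shows "((\<lambda>t. matrix_exp (t *\<^sub>R A) $ i $ j) has_real_derivative
           (A ** matrix_exp (t *\<^sub>R A)) $ i $ j) (at t)"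
proof -
  let ?c = "\<lambda>i j k. matrix_power A k $ i $ j / fact k"
  have "((\<lambda>t. \<Sum>k. ?c i j k * t ^ k) has_real_derivative (\<Sum>k. diffs (?c i j) k * t ^ k)) (at t)"
    by (rule termdiffs_strong_converges_everywhere) (rule summable_matrix_power_entry)
  \<comment> \<open>The factor \<open>k + 1\<close> produced by \<open>diffs\<close> reduces the
    factorial of \<open>k + 1\<close> to that of \<open>k\<close>, and the power
    \<open>Suc k\<close> leaves one factor \<open>A\<close> in front.\<close>
  moreover have "diffs (?c i j) k * t ^ k = (\<Sum>l\<in>UNIV. A $ i $ l * (?c l j k * t ^ k))" for k
    by (simp add: diffs_def matrix_matrix_mult_def sum_distrib_left sum_distrib_right
        sum_divide_distrib mult_ac) 
  moreover have "(\<lambda>k. \<Sum>l\<in>UNIV. A $ i $ l * (?c l j k * t ^ k)) sums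
      ((A ** matrix_exp (t *\<^sub>R A)) $ i $ j)"
    unfolding matrix_matrix_mult_def vec_lambda_beta
    by (intro sums_sum sums_mult matrix_exp_entry_sums)
  ultimately show ?thesis
    by (simp only: sums_unique[OF matrix_exp_entry_sums, symmetric] sums_iff)
qed

lemma matrix_exp_zero: "matrix_exp 0 = (mat 1 :: real ^ 'n ^ 'n)"
proof -
  have "matrix_exp 0 $ i $ j = (mat 1 :: real ^ 'n ^ 'n) $ i $ j" for i j
  proof -
    have "(\<lambda>k. matrix_power (0 :: real ^ 'n ^ 'n) k $ i $ j / fact k * 0 ^ k) sums (matrix_exp 0 $ i $ j)"
      using matrix_exp_entry_sums[of "0 :: real ^ 'n ^ 'n" i j 0] by simp
    from sums_unique2[OF this powser_sums_zero] show ?thesis by simp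
  qed
  then show ?thesis unfolding vec_eq_iff by blast
qed

text \<open>The left-hand side does not depend on \<open>t\<close>: its \<open>t\<close>-derivative vanishes because \<open>A\<close> commutes
  with its exponentials.\<close>

lemma matrix_exp_mult_minus:
  fixes A :: "real ^ 'n ^ 'n"
  shows "matrix_exp ((s + t) *\<^sub>R A) ** matrix_exp ((- t) *\<^sub>R A) = matrix_exp (s *\<^sub>R A)"
proof -
  let ?E = "\<lambda>t. matrix_exp (t *\<^sub>R A)"
  have d0: "((\<lambda>t. (?E (s + t) ** ?E (- t)) $ i $ j) has_real_derivative 0) (at t)" for i j t
  proof -
    have d1: "((\<lambda>t. ?E (s + t) $ i $ l) has_real_derivative (?E (s + t) ** A) $ i $ l) (at t)" for l
      using has_derivative_matrix_exp_entry[of A i l "s + t"]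
      by (simp add: DERIV_shift matrix_exp_commute add.commute[of s])
    have d2: "((\<lambda>t. ?E (- t) $ l $ j) has_real_derivative - (A ** ?E (- t)) $ l $ j) (at t)" for l
      using has_derivative_matrix_exp_entry[of A l j "- t"]
        DERIV_mirror[of "\<lambda>t. ?E t $ l $ j" "(A ** ?E (- t)) $ l $ j" t] by simp
    have "((\<lambda>t. \<Sum>l\<in>UNIV. ?E (s + t) $ i $ l * ?E (- t) $ l $ j) has_real_derivative
        (\<Sum>l\<in>UNIV. (?E (s + t) ** A) $ i $ l * ?E (- t) $ l $ j
           + - (A ** ?E (- t)) $ l $ j * ?E (s + t) $ i $ l)) (at t)"
      by (intro DERIV_sum DERIV_mult d1 d2)
    also have "(\<Sum>l\<in>UNIV. (?E (s + t) ** A) $ i $ l * ?E (- t) $ l $ j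
           + - (A ** ?E (- t)) $ l $ j * ?E (s + t) $ i $ l)
        = ((?E (s + t) ** A) ** ?E (- t)) $ i $ j - (?E (s + t) ** (A ** ?E (- t))) $ i $ j"
      unfolding matrix_matrix_mult_def[of "?E (s + t) ** A"] matrix_matrix_mult_def[of "?E (s + t)" "A ** ?E (- t)"]
      by (simp add: sum_subtractf mult.commute)
    also have "\<dots> = 0" by (simp add: matrix_mul_assoc)
    finally show "((\<lambda>t. (?E (s + t) ** ?E (- t)) $ i $ j) has_real_derivative 0) (at t)"
      by (simp add: matrix_matrix_mult_def)
  qed
  have "(?E (s + t) ** ?E (- t)) $ i $ j = (?E (s + 0) ** ?E (- 0)) $ i $ j" for i j
    by (rule DERIV_isconst_all[of "\<lambda>t. (?E (s + t) ** ?E (- t)) $ i $ j" t 0]) (intro allI d0)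
  then have "?E (s + t) ** ?E (- t) = ?E (s + 0) ** ?E (- 0)"
    unfolding vec_eq_iff by blast
  then show ?thesis
    by (simp only: add_0_right minus_zero scaleR_zero_left matrix_exp_zero matrix_mul_rid)
qed

text \<open>The preceding identity with \<open>s + t\<close> and \<open>- t\<close> in place of
  \<open>s\<close> and \<open>t\<close>.\<close>

lemma matrix_exp_add:
  fixes A :: "real ^ 'n ^ 'n"
  shows "matrix_exp ((s + t) *\<^sub>R A) = matrix_exp (s *\<^sub>R A) ** matrix_exp (t *\<^sub>R A)"
  using matrix_exp_mult_minus[of "s + t" "- t" A]
  by (simp only: add.assoc right_minus add_0_right minus_minus)

section \<open>Multiplicativity, continuity and local bounds of matrix powers\<close>

lemma matrix_powr_one: "matrix_powr 1 B = (mat 1 :: real ^ 'n ^ 'n)"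
  by (simp add: matrix_powr_def matrix_exp_zero)

lemma matrix_powr_mult:
  fixes B :: "real ^ 'n ^ 'n"
  assumes "x > 0" "y > 0"
  shows "matrix_powr (x * y) B = matrix_powr x B ** matrix_powr y B"
  using assms by (simp add: matrix_powr_def ln_mult matrix_exp_add)

lemma matrix_powr_mult_vec:
  fixes B :: "real ^ 'n ^ 'n"
  assumes "x > 0" "y > 0"
  shows "matrix_powr x B *v (matrix_powr y B *v w) = matrix_powr (x * y) B *v w"
  using assms by (simp add: matrix_powr_mult matrix_vector_mul_assoc)

lemma matrix_powr_uminus:
  assumes "x > 0"
  shows "matrix_powr x (- B) = matrix_powr (inverse x) B"
  using assms by (simp add: matrix_powr_def ln_inverse)

lemma continuous_on_matrix_powr:
  fixes B :: "real ^ 'n ^ 'n"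
  assumes "continuous_on S f" "continuous_on S h" "\<And>x. x \<in> S \<Longrightarrow> f x > 0"
  shows "continuous_on S (\<lambda>x. matrix_powr (f x) B *v h x)"
proof -
  have *: "continuous_on UNIV (\<lambda>t. matrix_exp (t *\<^sub>R B) $ i $ j)" for i j
    using has_derivative_matrix_exp_entry[of B i j]
    by (meson DERIV_isCont continuous_at_imp_continuous_on)
  have "continuous_on S (\<lambda>x. ln (f x))"
    using assms by (intro continuous_on_ln) (auto simp: less_imp_neq[symmetric])
  then have "continuous_on S (\<lambda>x. matrix_powr (f x) B $ i $ j)" for i j
    unfolding matrix_powr_def by (rule continuous_on_compose2[OF *]) simp
  with assms(2) show ?thesis
    unfolding matrix_vector_mult_def
    by (intro continuous_on_vec_lambda continuous_on_sum continuous_on_mult)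
       (auto intro: continuous_on_component)
qed

text \<open>Each column of \<open>matrix_powr x B\<close> is continuous in \<open>x\<close>, hence
  bounded on the compact interval; summing the column bounds gives \<open>C\<close>. The maximum
  with 1 only keeps \<open>C\<close> positive.\<close>

lemma matrix_powr_bounded:
  fixes B :: "real ^ 'n ^ 'n"
  assumes "a > 0"
  obtains C where "C > 0"
    and "\<And>x v. a \<le> x \<Longrightarrow> x \<le> b \<Longrightarrow> norm (matrix_powr x B *v v) \<le> C * norm v"
proof -
  have "\<exists>c. \<forall>x\<in>{a..b}. norm (matrix_powr x B *v axis i 1) \<le> c" for i
  proof -
    have "continuous_on {a..b} (\<lambda>x. matrix_powr x B *v axis i 1)"
      using assms by (intro continuous_on_matrix_powr) auto
    then have "bounded ((\<lambda>x. matrix_powr x B *v axis i 1) ` {a..b})"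
      by (intro compact_imp_bounded compact_continuous_image) auto
    then show ?thesis by (auto simp: bounded_iff)
  qed
  then obtain c where c: "\<And>i x. x \<in> {a..b} \<Longrightarrow> norm (matrix_powr x B *v axis i 1) \<le> c i"
    by metis
  define C where "C = max 1 (\<Sum>i\<in>UNIV. c i)"
  have "norm (matrix_powr x B *v v) \<le> C * norm v" if x: "a \<le> x" "x \<le> b" for x v
  proof -
    have "matrix_powr x B *v v = matrix_powr x B *v (\<Sum>i\<in>UNIV. (v $ i) *\<^sub>R axis i 1)"
      using basis_expansion[of v] by (simp add: scalar_mult_eq_scaleR)
    also have "\<dots> = (\<Sum>i\<in>UNIV. (v $ i) *\<^sub>R (matrix_powr x B *v axis i 1))"
      by (simp add: linear_sum[OF matrix_vector_mul_linear] matrix_vector_mult_scaleR)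
    also have "norm \<dots> \<le> (\<Sum>i\<in>UNIV. c i * norm v)"
    proof (rule sum_norm_le)
      fix i
      have "\<bar>v $ i\<bar> * norm (matrix_powr x B *v axis i 1) \<le> norm v * c i"
        using c[of x i] x by (intro mult_mono component_le_norm_cart) auto
      then show "norm ((v $ i) *\<^sub>R (matrix_powr x B *v axis i 1)) \<le> c i * norm v"
        by (simp add: mult.commute)
    qed
    also have "\<dots> \<le> C * norm v"
      unfolding C_def sum_distrib_right[symmetric] by (intro mult_right_mono) auto
    finally show ?thesis .
  qed
  then show thesis by (intro that[of C]) (auto simp: C_def)
qed

lemma le_last_index: "i \<le> (last_index :: 'n::{finite,linorder})"
  by (simp add: last_index_def)

text \<open>The last row of an upper triangular matrix vanishes off the diagonal, and this persists
  in its powers and exponential. So the last coordinate obeys a scalar power law, which is how the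
  size of \<open>g\<close> in that coordinate is controlled throughout.\<close>

lemma matrix_powr_last:
  fixes B :: "real ^ ('n::{finite,linorder}) ^ ('n::{finite,linorder})"
  assumes upper: "\<And>i j. j < i \<Longrightarrow> B $ i $ j = 0" and "x > 0"
  shows "(matrix_powr x B *v w) $ last_index = x powr (B $ last_index $ last_index) * w $ last_index"
proof -
  let ?n = "last_index :: 'n::{finite,linorder}"
  have row: "B $ ?n $ j = (if j = ?n then B $ ?n $ ?n else 0)" for j
    using upper[of j ?n] le_last_index[of j] by auto
  have pow: "matrix_power B k $ ?n $ j = (if j = ?n then (B $ ?n $ ?n) ^ k else 0)" for k j
  proof (induction k)
    case 0
    then show ?case by (auto simp: mat_def)
  next
    case (Suc k)
    have "matrix_power B (Suc k) $ ?n $ j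
        = (\<Sum>l\<in>UNIV. (if l = ?n then B $ ?n $ ?n else 0) * matrix_power B k $ l $ j)"
      by (simp only: matrix_power.simps matrix_matrix_mult_def vec_lambda_beta row[symmetric])
    then show ?case using Suc by (simp add: mult_delta_left)
  qed
  have "matrix_exp (t *\<^sub>R B) $ ?n $ j = (if j = ?n then exp (t * B $ ?n $ ?n) else 0)" for t j
  proof (rule sums_unique2[OF matrix_exp_entry_sums])
    show "(\<lambda>k. matrix_power B k $ ?n $ j / fact k * t ^ k) sums
        (if j = ?n then exp (t * B $ ?n $ ?n) else 0)"
      using exp_converges[of "t * B $ ?n $ ?n"]
      by (simp add: pow power_mult_distrib divide_inverse mult_ac)
  qed
  then have "matrix_powr x B $ ?n $ j = (if j = ?n then x powr (B $ ?n $ ?n) else 0)" for j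
    using \<open>x > 0\<close> by (simp add: matrix_powr_def powr_def mult.commute)
  then show ?thesis
    by (simp add: matrix_vector_mult_def mult_delta_left)
qed

section \<open>Uniform convergence\<close>

text \<open>Replaces the coordinatewise Landau relation by one estimate for the norm, the form used
  in all later arguments. The l1 bound for the norm explains the division of \<open>e\<close> by the
  dimension.\<close>

lemma small_o_last_iff:
  "small_o_last h g \<longleftrightarrow> (\<forall>e>0. \<forall>\<^sub>F t in at_top. norm (h t) \<le> e * \<bar>g t $ last_index\<bar>)"
    (is "?L = ?R") for h g :: "real \<Rightarrow> real ^ ('n::{finite,linorder})"
proof
  assume L: ?L
  show ?R
  proof (intro allI impI)
    fix e :: real assume "e > 0"
    then have "e / CARD('n) > 0" by simp
    with L have "\<forall>i. \<forall>\<^sub>F t in at_top. \<bar>h t $ i\<bar> \<le> e / CARD('n) * \<bar>g t $ last_index\<bar>"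
      unfolding small_o_last_def smallo_def by (simp only: mem_Collect_eq real_norm_def) blast
    then have "\<forall>\<^sub>F t in at_top. \<forall>i. \<bar>h t $ i\<bar> \<le> e / CARD('n) * \<bar>g t $ last_index\<bar>"
      by (intro eventually_all_finite) blast
    then show "\<forall>\<^sub>F t in at_top. norm (h t) \<le> e * \<bar>g t $ last_index\<bar>"
    proof eventually_elim
      case (elim t)
      have "norm (h t) \<le> (\<Sum>i\<in>UNIV. \<bar>h t $ i\<bar>)" by (rule norm_le_l1_cart)
      also have "\<dots> \<le> (\<Sum>i\<in>(UNIV::'n set). e / CARD('n) * \<bar>g t $ last_index\<bar>)"
        using elim by (intro sum_mono) auto
      finally show ?case by simp
    qed
  qed
next
  assume R: ?R
  have "\<forall>\<^sub>F t in at_top. \<bar>h t $ i\<bar> \<le> e * \<bar>g t $ last_index\<bar>" if "e > 0" for i e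
    using R[rule_format, OF that]
    by eventually_elim (meson component_le_norm_cart order_trans)
  then show ?L by (auto simp: small_o_last_def smallo_def)
qed

text \<open>Continuity of measure from below: the sets on which \<open>Q\<close> holds from index
  \<open>k\<close> on increase to the whole interval. This is the Egorov-type step that turns
  pointwise convergence into convergence uniform off a small set.\<close>

lemma eventually_measure_gt:
  fixes Q :: "nat \<Rightarrow> real \<Rightarrow> bool"
  assumes meas: "\<And>m. {y\<in>{a..b}. Q m y} \<in> sets lebesgue"
    and ev: "\<And>y. y \<in> {a..b} \<Longrightarrow> \<forall>\<^sub>F m in sequentially. Q m y"
    and "a \<le> b" "c < b - a"
  shows "\<forall>\<^sub>F k in sequentially. {y\<in>{a..b}. \<forall>m\<ge>k. Q m y} \<in> lmeasurable \<and>
           c < measure lebesgue {y\<in>{a..b}. \<forall>m\<ge>k. Q m y}"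
proof -
  let ?V = "\<lambda>k. {y\<in>{a..b}. \<forall>m\<ge>k. Q m y}"
  have V: "?V k \<in> sets lebesgue" for k
  proof -
    have "?V k = (\<Inter>m\<in>{k..}. {y\<in>{a..b}. Q m y})" by auto
    also have "\<dots> \<in> sets lebesgue"
      by (rule sets.countable_INT') (use meas in auto)
    finally show ?thesis .
  qed
  have fm: "?V k \<in> lmeasurable" for k
    by (rule fmeasurableI2[OF _ _ V, of "{a..b}"]) auto
  have U: "(\<Union>k. ?V k) = {a..b}"
  proof (intro equalityI subsetI)
    fix y assume "y \<in> {a..b}"
    with ev obtain k where "\<forall>m\<ge>k. Q m y" unfolding eventually_sequentially by blast
    with \<open>y \<in> {a..b}\<close> show "y \<in> (\<Union>k. ?V k)" by blast
  qed blast
  have "(\<lambda>k. measure lebesgue (?V k)) \<longlonglongrightarrow> measure lebesgue (\<Union>k. ?V k)"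
  proof (rule Lim_measure_incseq)
    show "incseq ?V" by (auto simp: incseq_def)
    show "range ?V \<subseteq> sets lebesgue" by (intro image_subsetI V)
    show "emeasure lebesgue (\<Union>k. ?V k) \<noteq> \<infinity>" unfolding U using \<open>a \<le> b\<close> by simp
  qed
  moreover have "measure lebesgue (\<Union>k. ?V k) = b - a"
    unfolding U using \<open>a \<le> b\<close> by simp
  ultimately have "(\<lambda>k. measure lebesgue (?V k)) \<longlonglongrightarrow> b - a"
    by (simp only:)
  then have "\<forall>\<^sub>F k in sequentially. c < measure lebesgue (?V k)"
    using \<open>c < b - a\<close> by (rule order_tendstoD)
  then show ?thesis
    by (rule eventually_mono) (intro conjI fm)
qed

text \<open>Dilation by \<open>x\<close> keeps \<open>W\<close> inside [1, 4] and does not decrease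
  its measure, so disjointness would give a subset of [1, 4] of measure greater than 5/2 + 1/2 =
  3.\<close>

lemma lmeasurable_scale_Int_nonempty:
  fixes x :: real
  assumes V: "V \<in> lmeasurable" "V \<subseteq> {1..4}" "5/2 < measure lebesgue V"
    and W: "W \<in> lmeasurable" "W \<subseteq> {1..2}" "1/2 < measure lebesgue W"
    and x: "1 \<le> x" "x \<le> 2"
  shows "\<exists>w\<in>W. x * w \<in> V"
proof (rule ccontr)
  assume "\<not> ?thesis"
  then have disj: "V \<inter> (*) x ` W = {}" by auto
  \<comment> \<open>Measurability is available for preimages, so the dilated set is written as
    one.\<close>
  have "(*) x ` W = (*) (1 / x) -` W"
  proof (intro equalityI subsetI)
    fix y assume "y \<in> (*) (1 / x) -` W"
    then show "y \<in> (*) x ` W" using x by (intro image_eqI[of _ _ "1 / x * y"]) auto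
  qed (use x in auto)
  then have "(*) x ` W \<in> sets lebesgue"
    using measurable_sets[OF lebesgue_measurable_scaling[of "1 / x"], of W] W(1)
    by (simp add: fmeasurableD vimage_def)
  moreover have "emeasure lebesgue ((*) x ` W) < \<infinity>"
    using emeasure_lebesgue_affine[of x 0 W] W(1)
    by (simp add: ennreal_mult_less_top fmeasurable_def del: emeasure_completion)
  ultimately have xW: "(*) x ` W \<in> lmeasurable"
    by (simp add: fmeasurable_def)
  have "measure lebesgue ((*) x ` W) = x * measure lebesgue W"
    using measure_lebesgue_affine[of x 0 W] x by simp
  also have "\<dots> \<ge> 1 * measure lebesgue W"
    using x by (intro mult_right_mono) auto
  finally have "1/2 < measure lebesgue ((*) x ` W)" using W by simp
  moreover have "x * w \<le> 2 * 2" "1 * 1 \<le> x * w" if "w \<in> W" for w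
    using that W(2) x mult_mono[of x 2 w 2] mult_mono[of 1 x 1 w] by fastforce+
  then have "V \<union> (*) x ` W \<subseteq> {1..4}" using V(2) by auto
  then have "measure lebesgue (V \<union> (*) x ` W) \<le> measure lebesgue {1..4::real}"
    by (rule measure_mono_fmeasurable) (use V(1) xW in auto)
  then have "measure lebesgue V + measure lebesgue ((*) x ` W) \<le> 3"
    using measure_Un2[OF V(1) xW] disj by (simp add: Diff_triv Int_commute)
  ultimately show False using V by simp
qed

lemma borel_measurable_shift_error:
  fixes g :: "real \<Rightarrow> real ^ 'n" and B :: "real ^ 'n ^ 'n"
  assumes "g \<in> borel_measurable lebesgue" and "a > 0"
  shows "{y\<in>{a..b}. norm (g (s * y) - matrix_powr y B *v w) \<le> c} \<in> sets lebesgue"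
proof -
  have 1: "(\<lambda>y. g (s * y)) \<in> borel_measurable (lebesgue_on {a..b})"
    using measurable_comp[OF lebesgue_measurable_scaling assms(1), of s]
    by (intro measurable_restrict_space1) (simp add: o_def)
  have 2: "(\<lambda>y. matrix_powr y B *v w) \<in> borel_measurable (lebesgue_on {a..b})"
    using \<open>a > 0\<close> by (intro continuous_imp_measurable_on_sets_lebesgue continuous_on_matrix_powr) auto
  have "{y\<in>space (lebesgue_on {a..b}). norm (g (s * y) - matrix_powr y B *v w) \<le> c}
      \<in> sets (lebesgue_on {a..b})"
    by (intro borel_measurable_le measurable_compose[OF _ borel_measurable_norm]
        borel_measurable_diff 1 2 borel_measurable_const)
  then show ?thesis
    unfolding space_lebesgue_on by (subst (asm) sets_restrict_space_iff) auto
qed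

text \<open>If uniformity failed along \<open>t\<^sub>k\<close> and \<open>x\<^sub>k\<close>, then by measurability both the
  shifts from \<open>t\<^sub>k\<close> and those from \<open>x\<^sub>k t\<^sub>k\<close> are well approximated off small sets, and some point
  \<open>x\<^sub>k w t\<^sub>k\<close> can be reached either way. Cancelling \<open>w\<^sup>B\<close> contradicts the choice of \<open>x\<^sub>k\<close>.\<close>

lemma uniform_convergence:
  fixes g :: "real \<Rightarrow> real ^ ('n::{finite,linorder})"
    and B :: "real ^ ('n::{finite,linorder}) ^ ('n::{finite,linorder})"
  assumes meas: "g \<in> borel_measurable lebesgue"
    and upper: "\<And>i j. j < i \<Longrightarrow> B $ i $ j = 0"
    and nz: "\<forall>\<^sub>F t in at_top. g t $ last_index \<noteq> 0"
    and lim: "\<And>x. x > 0 \<Longrightarrow> small_o_last (\<lambda>t. g (x * t) - matrix_powr x B *v g t) g"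
    and "e > 0"
  shows "\<forall>\<^sub>F t in at_top. \<forall>x\<in>{1..2}.
           norm (g (x * t) - matrix_powr x B *v g t) \<le> e * \<bar>g t $ last_index\<bar>"
proof (rule ccontr)
  let ?n = "last_index :: 'n::{finite,linorder}"
  let ?P = "\<lambda>x. matrix_powr x B"
  assume "\<not> ?thesis"
  then have "\<exists>t\<ge>N. \<exists>x\<in>{1..2}. norm (g (x * t) - ?P x *v g t) > e * \<bar>g t $ ?n\<bar>" for N
    unfolding eventually_at_top_linorder by (meson not_le)
  then have "\<exists>t x. t \<ge> 1 + real k \<and> 1 \<le> x \<and> x \<le> 2 \<and> norm (g (x * t) - ?P x *v g t) > e * \<bar>g t $ ?n\<bar>" for k
    by (metis atLeastAtMost_iff)
  then obtain t x where t: "\<And>k. t k \<ge> 1 + real k" and x: "\<And>k. 1 \<le> x k" "\<And>k. x k \<le> 2"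
    and bad: "\<And>k. norm (g (x k * t k) - ?P (x k) *v g (t k)) > e * \<bar>g (t k) $ ?n\<bar>"
    by metis
  obtain C where C: "C > 0"
    "\<And>y v. 1/4 \<le> y \<Longrightarrow> y \<le> 4 \<Longrightarrow> norm (?P y *v v) \<le> C * norm v"
    using matrix_powr_bounded[of "1/4" 4 B] by auto
  \<comment> \<open>Bounds the scalar factor of the last coordinate on [1, 2] whatever the sign of
    the exponent.\<close>
  define E where "E = 2 powr \<bar>B $ ?n $ ?n\<bar>"
  have E: "E > 0" "\<And>y. 1 \<le> y \<Longrightarrow> y \<le> 2 \<Longrightarrow> y powr (B $ ?n $ ?n) \<le> E"
  proof -
    show "y powr (B $ ?n $ ?n) \<le> E" if "1 \<le> y" "y \<le> 2" for y
      unfolding E_def using that powr_mono[of "B $ ?n $ ?n" "\<bar>B $ ?n $ ?n\<bar>" y]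
        powr_mono2[of "\<bar>B $ ?n $ ?n\<bar>" y 2] by linarith
  qed (simp add: E_def)
  \<comment> \<open>The bound \<open>C * d \<le> 1/2\<close> lets a term be absorbed into the
    left-hand side below; the bound \<open>C * d * (2 * E + 2) \<le> e\<close> contradicts the
    choice of \<open>x k\<close> at the end.\<close>
  define d where "d = min (1/2) (e / (2 * E + 2)) / C"
  have "d > 0" using C E \<open>e > 0\<close> by (simp add: d_def)
  have "C * d = min (1/2) (e / (2 * E + 2))" using C by (simp add: d_def)
  then have "C * d \<le> 1/2" "C * d \<le> e / (2 * E + 2)"
    by (simp_all only: min.cobounded1 min.cobounded2)
  then have Cd: "C * d \<le> 1/2" "C * d * (2 * E + 2) \<le> e"
    using E by (simp_all add: pos_le_divide_eq)
  have lim': "\<forall>\<^sub>F k in sequentially. norm (g (s k * y) - ?P y *v g (s k)) \<le> d * \<bar>g (s k) $ ?n\<bar>"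
    if s: "filterlim s at_top sequentially" and "y > 0" for s y
  proof -
    have "\<forall>\<^sub>F t in at_top. norm (g (t * y) - ?P y *v g t) \<le> d * \<bar>g t $ ?n\<bar>"
      using lim[OF \<open>y > 0\<close>] \<open>d > 0\<close> unfolding small_o_last_iff mult.commute[of _ y] by blast
    then show ?thesis by (rule eventually_compose_filterlim[OF _ s])
  qed
  have ft: "filterlim t at_top sequentially"
    by (rule filterlim_at_top_mono[OF filterlim_real_sequentially])
       (intro always_eventually allI order_trans[OF _ t], simp)
  have "1 * t k \<le> x k * t k" for k using x(1)[of k] t[of k] by (intro mult_right_mono) auto
  then have fxt: "filterlim (\<lambda>k. x k * t k) at_top sequentially"
    by (intro filterlim_at_top_mono[OF ft] always_eventually) auto
  let ?QV = "\<lambda>m y. norm (g (t m * y) - ?P y *v g (t m)) \<le> d * \<bar>g (t m) $ ?n\<bar>"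
  let ?QW = "\<lambda>m y. norm (g (x m * t m * y) - ?P y *v g (x m * t m)) \<le> d * \<bar>g (x m * t m) $ ?n\<bar>"
  have "\<forall>\<^sub>F k in sequentially. {y\<in>{1..4}. \<forall>m\<ge>k. ?QV m y} \<in> lmeasurable \<and>
      5/2 < measure lebesgue {y\<in>{1..4}. \<forall>m\<ge>k. ?QV m y}"
    by (intro eventually_measure_gt borel_measurable_shift_error meas lim'[OF ft]) auto
  moreover have "\<forall>\<^sub>F k in sequentially. {y\<in>{1..2}. \<forall>m\<ge>k. ?QW m y} \<in> lmeasurable \<and>
      1/2 < measure lebesgue {y\<in>{1..2}. \<forall>m\<ge>k. ?QW m y}"
    by (intro eventually_measure_gt borel_measurable_shift_error meas lim'[OF fxt]) auto
  ultimately have "\<forall>\<^sub>F k in sequentially. \<exists>w\<in>{y\<in>{1..2}. \<forall>m\<ge>k. ?QW m y}. x k * w \<in> {y\<in>{1..4}. \<forall>m\<ge>k. ?QV m y}"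
  proof eventually_elim
    case (elim k)
    show ?case
      by (rule lmeasurable_scale_Int_nonempty[OF conjunct1[OF elim(1)] _ conjunct2[OF elim(1)]
            conjunct1[OF elim(2)] _ conjunct2[OF elim(2)] x]) blast+
  qed
  moreover have "\<forall>\<^sub>F k in sequentially. g (t k) $ ?n \<noteq> 0"
    by (rule eventually_compose_filterlim[OF nz ft])
  ultimately have "\<forall>\<^sub>F k in sequentially. False"
  proof eventually_elim
    case (elim k)
    then obtain w where w: "1 \<le> w" "w \<le> 2" "?QW k w" "?QV k (x k * w)" by auto
    let ?D = "g (x k * t k) - ?P (x k) *v g (t k)"
    let ?p = "\<bar>g (t k) $ ?n\<bar>" and ?q = "\<bar>g (x k * t k) $ ?n\<bar>"
    have "?P w *v ?D = (g (t k * (x k * w)) - ?P (x k * w) *v g (t k))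
        - (g (x k * t k * w) - ?P w *v g (x k * t k))"
      using w x[of k] matrix_powr_mult_vec[of w "x k" B "g (t k)"]
      by (simp add: matrix_vector_mult_diff_distrib mult_ac)
    then have PD: "norm (?P w *v ?D) \<le> d * (?p + ?q)"
      using w(3,4) norm_triangle_ineq4[of "g (t k * (x k * w)) - ?P (x k * w) *v g (t k)"
          "g (x k * t k * w) - ?P w *v g (x k * t k)"] by (simp add: distrib_left)
    have "?P (1 / w) *v (?P w *v ?D) = ?D"
      using w matrix_powr_mult_vec[of "1 / w" w B ?D] by (simp add: matrix_powr_one)
    moreover have "norm (?P (1 / w) *v (?P w *v ?D)) \<le> C * norm (?P w *v ?D)"
      using w by (intro C) (auto simp: field_simps)
    ultimately have "norm ?D \<le> C * norm (?P w *v ?D)" by simp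
    also have "\<dots> \<le> C * (d * (?p + ?q))" using PD C by simp
    finally have D: "norm ?D \<le> C * d * (?p + ?q)" by simp
    have "(?P (x k) *v g (t k)) $ ?n = x k powr (B $ ?n $ ?n) * g (t k) $ ?n"
      using x(1)[of k] by (intro matrix_powr_last upper) auto
    \<comment> \<open>The error bound still involves \<open>?q\<close>. The last coordinate bounds
      \<open>?q\<close> by a multiple of \<open>?p\<close>, once half of \<open>?q\<close> has been
      moved to the left.\<close>
    then have "g (x k * t k) $ ?n = x k powr (B $ ?n $ ?n) * g (t k) $ ?n + ?D $ ?n"
      by simp
    then have "?q \<le> \<bar>x k powr (B $ ?n $ ?n) * g (t k) $ ?n\<bar> + \<bar>?D $ ?n\<bar>"
      by (metis abs_triangle_ineq)
    also have "\<dots> = x k powr (B $ ?n $ ?n) * ?p + \<bar>?D $ ?n\<bar>"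
      by (simp only: abs_mult abs_of_nonneg[OF powr_ge_zero])
    also have "\<dots> \<le> E * ?p + C * d * (?p + ?q)"
      using D E(2)[OF x] by (intro add_mono mult_right_mono order_trans[OF component_le_norm_cart]) auto
    also have "\<dots> \<le> E * ?p + 1/2 * (?p + ?q)"
      using Cd(1) by (intro add_mono mult_right_mono) auto
    finally have "?q \<le> (2 * E + 1) * ?p" by (simp add: field_simps)
    then have "norm ?D \<le> C * d * (?p + (2 * E + 1) * ?p)"
      using C \<open>d > 0\<close> by (intro order_trans[OF D] mult_left_mono add_left_mono) auto
    also have "\<dots> = C * d * (2 * E + 2) * ?p" by (simp add: field_simps)
    also have "\<dots> \<le> e * ?p" by (intro mult_right_mono Cd) auto
    finally show False using bad[of k] by simp
  qed
  then show False by simp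
qed

section \<open>Regular variation from the representation\<close>

lemma norm_integral_le_const:
  fixes f :: "real \<Rightarrow> 'a::euclidean_space"
  assumes "f integrable_on {s..t}" "s \<le> t" "\<And>u. u \<in> {s..t} \<Longrightarrow> norm (f u) \<le> c"
  shows "norm (integral {s..t} f) \<le> c * (t - s)"
proof -
  have "norm (integral {s..t} f) \<le> integral {s..t} (\<lambda>_. c)"
    by (rule integral_norm_bound_integral) (use assms in auto)
  then show ?thesis using assms(2) by (simp add: mult.commute)
qed

text \<open>Let \<open>s\<close> maximise the absolute value of \<open>H\<close> on the interval
  from \<open>t\<close> to \<open>X * t\<close>. The integral of \<open>k\<close> from
  \<open>t\<close> to \<open>s\<close> is then at most half of that maximum, so the other half is at
  most the absolute value of \<open>H t\<close>. This replaces a Gronwall argument and needs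
  \<open>H\<close> only as an indefinite integral.\<close>

lemma eventually_locally_bounded_of_small_derivative:
  fixes H k :: "real \<Rightarrow> real"
  assumes int: "\<And>t. t \<ge> a \<Longrightarrow> k integrable_on {a..t}"
    and H: "\<And>t. t \<ge> a \<Longrightarrow> H t = c + integral {a..t} k"
    and small: "\<And>d. d > 0 \<Longrightarrow> \<forall>\<^sub>F u in at_top. \<bar>k u\<bar> \<le> inverse u * (d * \<bar>H u\<bar>)"
    and "X \<ge> 1"
  shows "\<forall>\<^sub>F t in at_top. \<forall>u\<in>{t..X*t}. \<bar>H u\<bar> \<le> 2 * \<bar>H t\<bar>"
proof -
  \<comment> \<open>The integrand is of order \<open>1 / t\<close> and the interval has length at
    most \<open>X * t\<close>; the factor \<open>1 / (2 * X)\<close> makes the product one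
    half.\<close>
  have "1 / (2 * X) > 0" using \<open>X \<ge> 1\<close> by simp
  from eventually_all_ge_at_top[OF small[OF this]]
    eventually_ge_at_top[of a] eventually_ge_at_top[of 1]
  show ?thesis
  proof eventually_elim
    case (elim t)
    have tX: "t \<le> X * t" using elim(3) \<open>X \<ge> 1\<close> mult_right_mono[of 1 X t] by simp
    have ki: "k integrable_on {t..s}" if "t \<le> s" for s
      by (rule integrable_on_subinterval[OF int[of s]]) (use elim(2) that in simp_all)
    have diff: "H s = H t + integral {t..s} k" if "t \<le> s" for s
    proof -
      have "a \<le> s" using elim(2) that by simp
      have "integral {a..t} k + integral {t..s} k = integral {a..s} k"
        by (rule Henstock_Kurzweil_Integration.integral_combine[OF elim(2) that int[OF \<open>a \<le> s\<close>]])
      then show ?thesis unfolding H[OF \<open>a \<le> s\<close>] H[OF elim(2)] by linarith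
    qed
    have "continuous_on {t..X*t} (\<lambda>s. H t + integral {t..s} k)"
      by (rule continuous_on_add[OF continuous_on_const indefinite_integral_continuous_1[OF ki[OF tX]]])
    then have "continuous_on {t..X*t} H"
      by (rule continuous_on_eq) (rule diff[symmetric], simp)
    then have "continuous_on {t..X*t} (\<lambda>s. \<bar>H s\<bar>)"
      by (rule continuous_on_rabs)
    moreover have "compact {t..X*t}" "{t..X*t} \<noteq> {}" using tX by auto
    ultimately obtain s where s: "s \<in> {t..X*t}" "\<And>u. u \<in> {t..X*t} \<Longrightarrow> \<bar>H u\<bar> \<le> \<bar>H s\<bar>"
      using continuous_attains_sup[of "{t..X*t}" "\<lambda>s. \<bar>H s\<bar>"] by blast
    have "norm (integral {t..s} k) \<le> inverse t * (1 / (2 * X) * \<bar>H s\<bar>) * (s - t)"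
    proof (rule norm_integral_le_const)
      fix u assume u: "u \<in> {t..s}"
      have "\<bar>k u\<bar> \<le> inverse u * (1 / (2 * X) * \<bar>H u\<bar>)"
        using elim(1)[rule_format, of u] u by simp
      also have "\<dots> \<le> inverse t * (1 / (2 * X) * \<bar>H s\<bar>)"
        using elim(3) u s \<open>X \<ge> 1\<close> by (intro mult_mono le_imp_inverse_le) auto
      finally show "norm (k u) \<le> inverse t * (1 / (2 * X) * \<bar>H s\<bar>)" by simp
    qed (use s ki in auto)
    also have "\<dots> \<le> inverse t * (1 / (2 * X) * \<bar>H s\<bar>) * (X * t)"
      using s(1) elim(3) \<open>X \<ge> 1\<close> by (intro mult_left_mono) auto
    also have "\<dots> = \<bar>H s\<bar> / 2" using elim(3) \<open>X \<ge> 1\<close> by (simp add: field_simps)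
    finally have "\<bar>H s\<bar> \<le> 2 * \<bar>H t\<bar>" using diff[of s] s(1) by simp
    then show ?case using s(2) order_trans by blast
  qed
qed

text \<open>In the last coordinate the representation is scalar: up to \<eta>, \<open>g\<close>
  equals \<open>t powr b * H t\<close>. The integrand of \<open>H\<close> is small relative to
  \<open>H\<close> because \<phi> is small relative to \<open>g\<close>, so the bound for
  \<open>H\<close> carries over to \<open>g\<close>.\<close>

lemma representation_last_coordinate_bounded:
  fixes g \<eta> \<phi> :: "real \<Rightarrow> real ^ ('n::{finite,linorder})"
    and B :: "real ^ ('n::{finite,linorder}) ^ ('n::{finite,linorder})"
  defines "K \<equiv> \<lambda>u. inverse u *\<^sub>R (matrix_powr u (- B) *v \<phi> u)"
  assumes upper: "\<And>i j. j < i \<Longrightarrow> B $ i $ j = 0"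
    and "a > 0"
    and small: "small_o_last \<eta> g" "small_o_last \<phi> g"
    and int: "\<And>t. t \<ge> a \<Longrightarrow> K integrable_on {a..t}"
    and rep: "\<And>t. t \<ge> a \<Longrightarrow> g t = matrix_powr t B *v v + \<eta> t + matrix_powr t B *v integral {a..t} K"
    and "X \<ge> 1"
  shows "\<exists>C>0. \<forall>\<^sub>F t in at_top. \<forall>u\<in>{t..X*t}. \<bar>g u $ last_index\<bar> \<le> C * \<bar>g t $ last_index\<bar>"
proof -
  let ?n = "last_index :: 'n::{finite,linorder}"
  define b where "b = B $ ?n $ ?n"
  define H where "H = (\<lambda>t. v $ ?n + integral {a..t} (\<lambda>u. K u $ ?n))"
  have last: "(matrix_powr x B *v w) $ ?n = x powr b * w $ ?n" if "x > 0" for x w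
    unfolding b_def using upper that by (rule matrix_powr_last)
  have gH: "g t $ ?n = t powr b * H t + \<eta> t $ ?n" if "t \<ge> a" for t
  proof -
    have "integral {a..t} (\<lambda>u. K u $ ?n) = integral {a..t} K $ ?n"
      by (rule integral_component_eq_cart[OF int[OF that]])
    moreover have "t > 0" using that \<open>a > 0\<close> by simp
    ultimately show ?thesis
      by (simp only: rep[OF that] vector_add_component last H_def distrib_left)
  qed
  have half: "\<forall>\<^sub>F t in at_top. \<bar>\<eta> t $ ?n\<bar> \<le> 1/2 * \<bar>g t $ ?n\<bar>"
  proof -
    have "\<forall>\<^sub>F t in at_top. norm (\<eta> t) \<le> 1/2 * \<bar>g t $ ?n\<bar>"
      using small(1)[unfolded small_o_last_iff, rule_format, of "1/2"] by linarith
    then show ?thesis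
      by (rule eventually_mono) (rule order_trans[OF component_le_norm_cart])
  qed
  \<comment> \<open>As \<eta> accounts for at most half of the last coordinate of \<open>g\<close>,
    the two sizes agree up to a factor 2 in both directions.\<close>
  have cmp: "\<forall>\<^sub>F t in at_top. \<bar>g t $ ?n\<bar> \<le> 2 * (t powr b * \<bar>H t\<bar>) \<and> t powr b * \<bar>H t\<bar> \<le> 2 * \<bar>g t $ ?n\<bar>"
    using half eventually_ge_at_top[of a]
  proof eventually_elim
    case (elim t)
    have "\<bar>t powr b * H t\<bar> = t powr b * \<bar>H t\<bar>" by (simp add: abs_mult)
    then show ?case using elim gH[of t] by linarith
  qed
  have "\<forall>\<^sub>F t in at_top. \<forall>u\<in>{t..X*t}. \<bar>H u\<bar> \<le> 2 * \<bar>H t\<bar>"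
  proof (rule eventually_locally_bounded_of_small_derivative[OF _ _ _ \<open>X \<ge> 1\<close>])
    show "(\<lambda>u. K u $ ?n) integrable_on {a..t}" if "t \<ge> a" for t
      using integrable_linear[OF int[OF that] bounded_linear_vec_nth[of ?n]] by (simp add: o_def)
    show "H t = v $ ?n + integral {a..t} (\<lambda>u. K u $ ?n)" for t by (simp add: H_def)
    fix d :: real assume "d > 0"
    then have "\<forall>\<^sub>F u in at_top. norm (\<phi> u) \<le> d / 2 * \<bar>g u $ ?n\<bar>"
      using small(2)[unfolded small_o_last_iff, rule_format, of "d / 2"] by linarith
    then show "\<forall>\<^sub>F u in at_top. \<bar>K u $ ?n\<bar> \<le> inverse u * (d * \<bar>H u\<bar>)"
      using cmp eventually_gt_at_top[of 0]
    proof eventually_elim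
      case (elim u)
      have "K u $ ?n = inverse u * ((inverse u) powr b * \<phi> u $ ?n)"
        using elim last[of "inverse u" "\<phi> u"] by (simp add: K_def matrix_powr_uminus)
      then have "\<bar>K u $ ?n\<bar> = inverse u * ((inverse u) powr b * \<bar>\<phi> u $ ?n\<bar>)"
        using elim by (simp add: abs_mult)
      also have "\<dots> \<le> inverse u * ((inverse u) powr b * (d / 2 * (2 * (u powr b * \<bar>H u\<bar>))))"
      proof (intro mult_left_mono)
        have "\<bar>\<phi> u $ ?n\<bar> \<le> d / 2 * \<bar>g u $ ?n\<bar>"
          using elim(1) component_le_norm_cart order_trans by blast
        also have "\<dots> \<le> d / 2 * (2 * (u powr b * \<bar>H u\<bar>))"
          using elim \<open>d > 0\<close> by (intro mult_left_mono) auto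
        finally show "\<bar>\<phi> u $ ?n\<bar> \<le> d / 2 * (2 * (u powr b * \<bar>H u\<bar>))" .
      qed (use elim in auto)
      also have "\<dots> = inverse u * (((inverse u) powr b * u powr b) * (d * \<bar>H u\<bar>))"
        by simp
      also have "(inverse u) powr b * u powr b = 1"
        using elim by (simp flip: powr_mult)
      finally show ?case by simp
    qed
  qed
  \<comment> \<open>The constant 8 collects a factor 2 from the comparison at \<open>u\<close>, one
    from the bound on \<open>H\<close> and one from the comparison at \<open>t\<close>; the power of
    \<open>X\<close> bounds that of \<open>u / t\<close>.\<close>
  with eventually_all_ge_at_top[OF cmp] eventually_gt_at_top[of 0]
  have "\<forall>\<^sub>F t in at_top. \<forall>u\<in>{t..X*t}. \<bar>g u $ ?n\<bar> \<le> 8 * X powr \<bar>b\<bar> * \<bar>g t $ ?n\<bar>"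
  proof eventually_elim
    case (elim t)
    show ?case
    proof
      fix u assume u: "u \<in> {t..X*t}"
      have ut: "1 \<le> u / t" "u / t \<le> X" using u elim(2) by (auto simp: field_simps)
      have "u powr b = (u / t) powr b * t powr b"
        using u elim(2) by (simp flip: powr_mult)
      also have "(u / t) powr b \<le> X powr \<bar>b\<bar>"
        using powr_mono[of b "\<bar>b\<bar>" "u / t"] powr_mono2[of "\<bar>b\<bar>" "u / t" X] ut by linarith
      finally have ub: "u powr b \<le> X powr \<bar>b\<bar> * t powr b"
        by (simp add: mult_right_mono)
      have "\<bar>g u $ ?n\<bar> \<le> 2 * (u powr b * \<bar>H u\<bar>)"
        using elim(1)[rule_format, of u] u by simp
      also have "\<dots> \<le> 2 * ((X powr \<bar>b\<bar> * t powr b) * (2 * \<bar>H t\<bar>))"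
        using ub elim(3)[rule_format, OF u] by (intro mult_mono) auto
      also have "\<dots> = 4 * X powr \<bar>b\<bar> * (t powr b * \<bar>H t\<bar>)" by simp
      also have "\<dots> \<le> 4 * X powr \<bar>b\<bar> * (2 * \<bar>g t $ ?n\<bar>)"
        using elim(1)[rule_format, of t] by (intro mult_left_mono) auto
      finally show "\<bar>g u $ ?n\<bar> \<le> 8 * X powr \<bar>b\<bar> * \<bar>g t $ ?n\<bar>" by simp
    qed
  qed
  then show ?thesis using \<open>X \<ge> 1\<close> by (intro exI[of _ "8 * X powr \<bar>b\<bar>"]) simp
qed

lemma representation_shift_ge_1:
  fixes g \<eta> \<phi> :: "real \<Rightarrow> real ^ ('n::{finite,linorder})"
    and B :: "real ^ ('n::{finite,linorder}) ^ ('n::{finite,linorder})"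
  defines "K \<equiv> \<lambda>u. inverse u *\<^sub>R (matrix_powr u (- B) *v \<phi> u)"
  assumes upper: "\<And>i j. j < i \<Longrightarrow> B $ i $ j = 0"
    and "a > 0"
    and small: "small_o_last \<eta> g" "small_o_last \<phi> g"
    and int: "\<And>t. t \<ge> a \<Longrightarrow> K integrable_on {a..t}"
    and rep: "\<And>t. t \<ge> a \<Longrightarrow> g t = matrix_powr t B *v v + \<eta> t + matrix_powr t B *v integral {a..t} K"
    and "x \<ge> 1"
  shows "small_o_last (\<lambda>t. g (x * t) - matrix_powr x B *v g t) g"
  unfolding small_o_last_iff
proof (intro allI impI)
  fix e :: real assume "e > 0"
  let ?n = "last_index :: 'n::{finite,linorder}"
  obtain C where C: "C > 0"
    "\<forall>\<^sub>F t in at_top. \<forall>u\<in>{t..x*t}. \<bar>g u $ ?n\<bar> \<le> C * \<bar>g t $ ?n\<bar>"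
    using representation_last_coordinate_bounded[OF upper \<open>a > 0\<close> small int[unfolded K_def]
        rep[unfolded K_def] \<open>x \<ge> 1\<close>] by blast
  obtain D where D: "D > 0"
    "\<And>y w. 1 \<le> y \<Longrightarrow> y \<le> x \<Longrightarrow> norm (matrix_powr y B *v w) \<le> D * norm w"
    using matrix_powr_bounded[of 1 x B] by auto
  \<comment> \<open>The three summands of the denominator correspond to the errors from \<eta> at
    \<open>x * t\<close>, from \<eta> at \<open>t\<close>, and from the integral between
    them.\<close>
  define d where "d = e / (C + D + D * C * x)"
  have "C + D + D * C * x > 0" using C D \<open>x \<ge> 1\<close> by (intro add_pos_pos mult_pos_pos) auto
  then have d: "d > 0" "C * d + D * d + D * (d * C) * x = e"
  proof -
    assume *: "C + D + D * C * x > 0"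
    have "C * d + D * d + D * (d * C) * x = (C + D + D * C * x) * d" by (simp add: algebra_simps)
    also have "\<dots> = e" using * by (simp add: d_def)
    finally show "C * d + D * d + D * (d * C) * x = e" .
    show "d > 0" using * \<open>e > 0\<close> by (simp add: d_def)
  qed
  have "\<forall>\<^sub>F t in at_top. norm (\<eta> t) \<le> d * \<bar>g t $ ?n\<bar>" "\<forall>\<^sub>F t in at_top. norm (\<phi> t) \<le> d * \<bar>g t $ ?n\<bar>"
    using small \<open>d > 0\<close> unfolding small_o_last_iff by auto
  from eventually_all_ge_at_top[OF this(1)] eventually_all_ge_at_top[OF this(2)] C(2) eventually_ge_at_top[of a]
  show "\<forall>\<^sub>F t in at_top. norm (g (x * t) - matrix_powr x B *v g t) \<le> e * \<bar>g t $ ?n\<bar>"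
  proof eventually_elim
    case (elim t)
    let ?p = "\<bar>g t $ ?n\<bar>"
    have t: "t > 0" "t \<ge> a" using elim \<open>a > 0\<close> by auto
    have tx: "t \<le> x * t" using \<open>x \<ge> 1\<close> t mult_right_mono[of 1 x t] by simp
    have gu: "\<bar>g u $ ?n\<bar> \<le> C * ?p" if "u \<in> {t..x*t}" for u using elim(3) that by blast
    have Ki: "K integrable_on {t..x*t}"
      using int[of "x * t"] integrable_on_subinterval[of K "{a..x*t}" t "x * t"] tx t by auto
    let ?h = "\<lambda>w. matrix_powr (x * t) B *v w"
    have comb: "integral {a..x*t} K = integral {a..t} K + integral {t..x*t} K"
      using Henstock_Kurzweil_Integration.integral_combine[of a t "x * t" K] int[of "x * t"] tx t by simp
    \<comment> \<open>The terms with \<open>v\<close> and with the integral up to \<open>t\<close>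
      cancel by multiplicativity of the powers.\<close>
    have "g (x * t) - matrix_powr x B *v g t
        = \<eta> (x * t) - matrix_powr x B *v \<eta> t + ?h (integral {t..x*t} K)"
      using rep[of t] rep[of "x * t"] tx t \<open>x \<ge> 1\<close> unfolding comb
      by (simp add: matrix_vector_right_distrib matrix_powr_mult_vec)
    also have "norm \<dots> \<le> norm (\<eta> (x * t)) + norm (matrix_powr x B *v \<eta> t) + norm (?h (integral {t..x*t} K))"
      by (intro norm_triangle_mono norm_triangle_ineq4 order_refl)
    also have "\<dots> \<le> C * d * ?p + D * d * ?p + D * (d * C) * x * ?p"
    proof (intro add_mono)
      have "norm (\<eta> (x * t)) \<le> d * \<bar>g (x * t) $ ?n\<bar>" using elim(1) tx by blast
      also have "\<dots> \<le> d * (C * ?p)" using gu[of "x * t"] tx d by (intro mult_left_mono) auto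
      finally show "norm (\<eta> (x * t)) \<le> C * d * ?p" by (simp add: mult_ac)
      have "norm (matrix_powr x B *v \<eta> t) \<le> D * norm (\<eta> t)" using D(2) \<open>x \<ge> 1\<close> by blast
      also have "\<dots> \<le> D * (d * ?p)" using elim(1) D(1) by (intro mult_left_mono) auto
      finally show "norm (matrix_powr x B *v \<eta> t) \<le> D * d * ?p" by simp
      have "norm (integral {t..x*t} (?h \<circ> K)) \<le> inverse t * (D * (d * (C * ?p))) * (x * t - t)"
      proof (rule norm_integral_le_const)
        show "(?h \<circ> K) integrable_on {t..x*t}"
          by (rule integrable_linear[OF Ki]) simp
        fix u assume u: "u \<in> {t..x*t}"
        then have u0: "u > 0" and q: "1 \<le> x * t / u" "x * t / u \<le> x"
          using t \<open>x \<ge> 1\<close> by (auto simp: field_simps)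
        \<comment> \<open>The powers of \<open>x * t\<close> and of \<open>u\<close> combine into
          the power of a ratio in [1, x], on which \<open>D\<close> is a bound independent of
          \<open>t\<close>.\<close>
        have "?h (K u) = inverse u *\<^sub>R (matrix_powr (x * t / u) B *v \<phi> u)"
          using u0 t \<open>x \<ge> 1\<close>
          by (simp add: K_def matrix_powr_uminus matrix_vector_mult_scaleR matrix_powr_mult_vec divide_inverse)
        then have "norm (?h (K u)) = inverse u * norm (matrix_powr (x * t / u) B *v \<phi> u)"
          using u0 by simp
        also have "\<dots> \<le> inverse t * (D * (d * (C * ?p)))"
        proof (intro mult_mono le_imp_inverse_le)
          have "norm (matrix_powr (x * t / u) B *v \<phi> u) \<le> D * norm (\<phi> u)" by (rule D(2)[OF q])
          also have "\<dots> \<le> D * (d * \<bar>g u $ ?n\<bar>)" using elim(2) u D(1) by (intro mult_left_mono) auto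
          also have "\<dots> \<le> D * (d * (C * ?p))" using gu[OF u] D(1) d(1) by (intro mult_left_mono) auto
          finally show "norm (matrix_powr (x * t / u) B *v \<phi> u) \<le> D * (d * (C * ?p))" .
        qed (use t u in auto)
        finally show "norm ((?h \<circ> K) u) \<le> inverse t * (D * (d * (C * ?p)))" by simp
      qed (rule tx)
      also have "\<dots> \<le> inverse t * (D * (d * (C * ?p))) * (x * t)"
        using t D(1) d(1) C(1) by (intro mult_left_mono) auto
      also have "\<dots> = D * (d * C) * x * ?p" using t by (simp add: field_simps)
      also have "integral {t..x*t} (?h \<circ> K) = ?h (integral {t..x*t} K)"
        by (rule integral_linear[OF Ki]) simp
      finally show "norm (?h (integral {t..x*t} K)) \<le> D * (d * C) * x * ?p" .
    qed
    also have "\<dots> = e * ?p" unfolding d(2)[symmetric] by (simp add: distrib_right)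
    finally show ?case .
  qed
qed

text \<open>For \<open>x < 1\<close> substitute \<open>s = x t\<close> in the relation for \<open>1 / x\<close>, whose last coordinate also
  gives \<open>g\<^sub>n(x t) = O(g\<^sub>n(t))\<close>.\<close>

lemma small_o_last_shift_inverse:
  fixes g :: "real \<Rightarrow> real ^ ('n::{finite,linorder})"
    and B :: "real ^ ('n::{finite,linorder}) ^ ('n::{finite,linorder})"
  assumes upper: "\<And>i j. j < i \<Longrightarrow> B $ i $ j = 0"
    and "x > 0"
    and lim: "small_o_last (\<lambda>t. g (inverse x * t) - matrix_powr (inverse x) B *v g t) g"
  shows "small_o_last (\<lambda>t. g (x * t) - matrix_powr x B *v g t) g"
  unfolding small_o_last_iff
proof (intro allI impI)
  fix e :: real assume "e > 0"
  let ?n = "last_index :: 'n::{finite,linorder}"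
  define b where "b = B $ ?n $ ?n"
  define r where "r = inverse x powr b"
  have "r > 0" using \<open>x > 0\<close> by (simp add: r_def)
  obtain C where C: "C > 0" "\<And>w. norm (matrix_powr x B *v w) \<le> C * norm w"
    by (rule matrix_powr_bounded[OF \<open>x > 0\<close>, of x B]) (use that in blast)
  \<comment> \<open>The first bound yields \<open>r / 2 * ?q \<le> ?p\<close> by absorption; the
    second turns this into the required factor \<open>e\<close>.\<close>
  define d where "d = min (r / 2) (e * r / (2 * C))"
  have d: "d > 0" "d \<le> r / 2" "d \<le> e * r / (2 * C)"
    using \<open>e > 0\<close> \<open>r > 0\<close> C(1) unfolding d_def by (auto intro: min.cobounded1 min.cobounded2)
  have "filterlim (\<lambda>t. x * t) at_top at_top"
    by (rule filterlim_tendsto_pos_mult_at_top[OF tendsto_const \<open>x > 0\<close> filterlim_ident])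
  moreover have "\<forall>\<^sub>F s in at_top. norm (g (inverse x * s) - matrix_powr (inverse x) B *v g s) \<le> d * \<bar>g s $ ?n\<bar>"
    using lim d(1) unfolding small_o_last_iff by blast
  ultimately have "\<forall>\<^sub>F t in at_top. norm (g (inverse x * (x * t)) - matrix_powr (inverse x) B *v g (x * t)) \<le> d * \<bar>g (x * t) $ ?n\<bar>"
    by (rule eventually_compose_filterlim[rotated])
  then show "\<forall>\<^sub>F t in at_top. norm (g (x * t) - matrix_powr x B *v g t) \<le> e * \<bar>g t $ ?n\<bar>"
  proof eventually_elim
    case (elim t)
    let ?D = "g t - matrix_powr (inverse x) B *v g (x * t)"
    let ?p = "\<bar>g t $ ?n\<bar>" and ?q = "\<bar>g (x * t) $ ?n\<bar>"
    have D: "norm ?D \<le> d * ?q" using elim \<open>x > 0\<close> by (simp flip: mult.assoc)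
    have "(matrix_powr (inverse x) B *v g (x * t)) $ ?n = r * g (x * t) $ ?n"
      unfolding r_def b_def using \<open>x > 0\<close> by (intro matrix_powr_last upper) auto
    then have "r * g (x * t) $ ?n = g t $ ?n - ?D $ ?n" by simp
    moreover have "\<bar>r * g (x * t) $ ?n\<bar> = r * ?q" using \<open>r > 0\<close> by (simp add: abs_mult)
    moreover have "\<bar>?D $ ?n\<bar> \<le> r / 2 * ?q"
    proof -
      have "\<bar>?D $ ?n\<bar> \<le> d * ?q" by (rule order_trans[OF component_le_norm_cart D])
      also have "\<dots> \<le> r / 2 * ?q" by (intro mult_right_mono d) auto
      finally show ?thesis .
    qed
    ultimately have q: "r / 2 * ?q \<le> ?p" by linarith
    have "matrix_powr x B *v ?D = - (g (x * t) - matrix_powr x B *v g t)"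
      using \<open>x > 0\<close> by (simp add: matrix_vector_mult_diff_distrib matrix_powr_mult_vec matrix_powr_one)
    then have "norm (g (x * t) - matrix_powr x B *v g t) = norm (matrix_powr x B *v ?D)"
      by (simp only: norm_minus_cancel)
    also have "\<dots> \<le> C * (d * ?q)"
      using C(1) by (intro order_trans[OF C(2)] mult_left_mono D) auto
    also have "\<dots> \<le> C * (e * r / (2 * C) * ?q)"
      using C(1) by (intro mult_left_mono mult_right_mono d) auto
    also have "\<dots> = e * (r / 2 * ?q)" using C(1) by simp
    also have "\<dots> \<le> e * ?p" using \<open>e > 0\<close> by (intro mult_left_mono q) auto
    finally show ?case .
  qed
qed

section \<open>The representation from regular variation\<close>

lemma rate_vector_eventually_nonzero:
  "rate_vector g \<Longrightarrow> \<forall>\<^sub>F t in at_top. g t $ i \<noteq> 0"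
  unfolding rate_vector_def eventually_constant_sign_def
  by (metis (mono_tags, lifting) eventually_mono less_irrefl)

text \<open>Expansion in the standard basis gives a finite sum of measurable scalars times columns
  that are continuous on positive arguments.\<close>

lemma borel_measurable_matrix_powr:
  fixes f :: "real \<Rightarrow> real ^ 'n" and B :: "real ^ 'n ^ 'n"
  assumes f: "f \<in> borel_measurable (lebesgue_on S)" and S: "S \<in> sets lebesgue" "S \<subseteq> {0<..}"
  shows "(\<lambda>u. matrix_powr u B *v f u) \<in> borel_measurable (lebesgue_on S)"
proof -
  have "matrix_powr u B *v f u = (\<Sum>i\<in>UNIV. (f u $ i) *\<^sub>R (matrix_powr u B *v axis i 1))" for u
  proof -
    have "matrix_powr u B *v f u = matrix_powr u B *v (\<Sum>i\<in>UNIV. (f u $ i) *\<^sub>R axis i 1)"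
      using basis_expansion[of "f u"] by (simp add: scalar_mult_eq_scaleR)
    then show ?thesis
      by (simp add: linear_sum[OF matrix_vector_mul_linear] matrix_vector_mult_scaleR)
  qed
  moreover have "(\<lambda>u. f u $ i) \<in> borel_measurable (lebesgue_on S)" for i
    by (rule measurable_compose[OF f borel_measurable_continuous_onI]) (intro continuous_intros)
  moreover have "(\<lambda>u. matrix_powr u B *v axis i 1) \<in> borel_measurable (lebesgue_on S)" for i
    using S by (intro continuous_imp_measurable_on_sets_lebesgue continuous_on_matrix_powr) auto
  ultimately show ?thesis
    by (simp only:) (intro borel_measurable_sum borel_measurable_scaleR)
qed

lemma absolutely_integrable_matrix_powr:
  fixes f :: "real \<Rightarrow> real ^ 'n" and B :: "real ^ 'n ^ 'n"
  assumes f: "f \<in> borel_measurable (lebesgue_on {a..})" and "a > 0"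
    and bdd: "\<And>u. u \<in> {a..t} \<Longrightarrow> norm (f u) \<le> c"
  shows "(\<lambda>u. inverse u *\<^sub>R (matrix_powr u B *v f u)) absolutely_integrable_on {a..t}"
proof -
  obtain C where C: "C > 0"
    "\<And>x v. a \<le> x \<Longrightarrow> x \<le> t \<Longrightarrow> norm (matrix_powr x B *v v) \<le> C * norm v"
    using matrix_powr_bounded[OF \<open>a > 0\<close>, of t B] by blast
  have ft: "f \<in> borel_measurable (lebesgue_on {a..t})"
    by (rule measurable_restrict_mono[OF f]) auto
  show ?thesis
  proof (rule measurable_bounded_by_integrable_imp_absolutely_integrable)
    have "inverse \<in> borel_measurable (lebesgue_on {a..t})"
      using \<open>a > 0\<close> by (intro continuous_imp_measurable_on_sets_lebesgue continuous_intros) auto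
    then show "(\<lambda>u. inverse u *\<^sub>R (matrix_powr u B *v f u)) \<in> borel_measurable (lebesgue_on {a..t})"
      using \<open>a > 0\<close> by (intro borel_measurable_scaleR borel_measurable_matrix_powr ft) auto
    show "(\<lambda>u. inverse a * (C * c)) integrable_on {a..t}"
      by (rule integrable_const_ivl)
    fix u assume u: "u \<in> {a..t}"
    have "norm (matrix_powr u B *v f u) \<le> C * norm (f u)" using C(2) u by simp
    also have "\<dots> \<le> C * c" using C(1) bdd[OF u] by simp
    finally have "inverse u * norm (matrix_powr u B *v f u) \<le> inverse a * (C * c)"
      using u \<open>a > 0\<close> by (intro mult_mono le_imp_inverse_le) auto
    then show "norm (inverse u *\<^sub>R (matrix_powr u B *v f u)) \<le> inverse a * (C * c)"
      using u \<open>a > 0\<close> by simp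
  qed simp
qed

lemma continuous_on_indefinite_integral_atLeast:
  fixes f :: "real \<Rightarrow> 'a::banach"
  assumes "\<And>t. t \<ge> a \<Longrightarrow> f integrable_on {a..t}"
  shows "continuous_on {a..} (\<lambda>t. integral {a..t} f)"
  unfolding continuous_on_eq_continuous_within
proof
  fix x assume x: "x \<in> {a..}"
  then have "continuous_on {a..x+1} (\<lambda>t. integral {a..t} f)"
    by (intro indefinite_integral_continuous_1 assms) simp
  then have "continuous (at x within {a..x+1}) (\<lambda>t. integral {a..t} f)"
    using x by (simp add: continuous_on_eq_continuous_within)
  moreover have "at x within {a..} = at x within {a..x+1}"
    by (rule at_within_nhd[of x "{..<x+1}"]) auto
  ultimately show "continuous (at x within {a..}) (\<lambda>t. integral {a..t} f)" by simp
qed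

text \<open>A step by a ratio in [1, 2] multiplies the norm by at most \<open>D + 1\<close>, and
  finitely many doublings of \<open>T\<close> pass any \<open>M\<close>. Local boundedness of a
  merely measurable \<open>g\<close> is what makes the averages below exist.\<close>

lemma uniform_shift_imp_locally_bounded:
  fixes g :: "real \<Rightarrow> real ^ ('n::{finite,linorder})"
    and B :: "real ^ ('n::{finite,linorder}) ^ ('n::{finite,linorder})"
  assumes "T > 0"
    and ub: "\<And>t x. t \<ge> T \<Longrightarrow> x \<in> {1..2} \<Longrightarrow> norm (g (x * t) - matrix_powr x B *v g t) \<le> \<bar>g t $ last_index\<bar>"
  shows "\<exists>c. \<forall>t\<in>{T..M}. norm (g t) \<le> c"
proof -
  obtain D where D: "D > 0"
    "\<And>x v. 1 \<le> x \<Longrightarrow> x \<le> 2 \<Longrightarrow> norm (matrix_powr x B *v v) \<le> D * norm v"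
    by (rule matrix_powr_bounded[of 1 2 B]) (use that in auto)
  have step: "norm (g (x * t)) \<le> (D + 1) * norm (g t)" if "t \<ge> T" "x \<in> {1..2}" for t x
  proof -
    have "norm (g (x * t)) \<le> norm (matrix_powr x B *v g t) + norm (g (x * t) - matrix_powr x B *v g t)"
      by (rule norm_triangle_sub)
    also have "\<dots> \<le> D * norm (g t) + norm (g t)"
      using D(2) that by (intro add_mono order_trans[OF ub[OF that]] component_le_norm_cart) auto
    finally show ?thesis by (simp add: distrib_right)
  qed
  have bound: "\<forall>t\<in>{T..2 ^ k * T}. norm (g t) \<le> (D + 1) ^ k * norm (g T)" for k
  proof (induction k)
    case 0
    then show ?case by auto
  next
    case (Suc k)
    show ?case
    proof
      fix t assume t: "t \<in> {T..2 ^ Suc k * T}"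
      \<comment> \<open>The maximum keeps \<open>s\<close> in the range already covered while
        \<open>t / s\<close> stays in [1, 2].\<close>
      define s where "s = max T (t / 2)"
      have "1 * T \<le> 2 ^ k * T" using \<open>T > 0\<close> by (intro mult_right_mono) auto
      then have s: "s \<in> {T..2 ^ k * T}" "t / s \<in> {1..2}" "s > 0"
        using t \<open>T > 0\<close> by (auto simp: s_def max_def divide_simps)
      have "norm (g t) \<le> (D + 1) * norm (g s)" using step[of s "t / s"] s by simp
      also have "\<dots> \<le> (D + 1) * ((D + 1) ^ k * norm (g T))"
        using Suc.IH s(1) D(1) by (intro mult_left_mono) auto
      finally show "norm (g t) \<le> (D + 1) ^ Suc k * norm (g T)" by simp
    qed
  qed
  obtain k where "M / T < 2 ^ k" using real_arch_pow[of 2 "M / T"] by auto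
  then have "{T..M} \<subseteq> {T..2 ^ k * T}" using \<open>T > 0\<close> by (auto simp: divide_simps)
  with bound[of k] show ?thesis by blast
qed

text \<open>The subtracted term is the mean of \<open>(t/u)\<^sup>B g(u)\<close> over \<open>[t, 2t]\<close> with respect to
  \<open>du / u\<close>, a measure of total mass \<open>ln 2\<close>.\<close>

lemma small_o_last_average_error:
  fixes g :: "real \<Rightarrow> real ^ ('n::{finite,linorder})"
    and B :: "real ^ ('n::{finite,linorder}) ^ ('n::{finite,linorder})"
  defines "K \<equiv> \<lambda>u. inverse u *\<^sub>R (matrix_powr u (- B) *v g u)"
  assumes "a > 0"
    and int: "\<And>t. t \<ge> a \<Longrightarrow> K integrable_on {a..t}"
    and unif: "\<And>e. e > 0 \<Longrightarrow> \<forall>\<^sub>F t in at_top. \<forall>x\<in>{1..2}.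
           norm (g (x * t) - matrix_powr x B *v g t) \<le> e * \<bar>g t $ last_index\<bar>"
  shows "small_o_last (\<lambda>t. g t - (1 / ln 2) *\<^sub>R (matrix_powr t B *v integral {t..2*t} K)) g"
  unfolding small_o_last_iff
proof (intro allI impI)
  fix e :: real assume "e > 0"
  let ?n = "last_index :: 'n::{finite,linorder}"
  obtain D where D: "D > 0"
    "\<And>x v. 1/2 \<le> x \<Longrightarrow> x \<le> 1 \<Longrightarrow> norm (matrix_powr x B *v v) \<le> D * norm v"
    by (rule matrix_powr_bounded[of "1/2" 1 B]) (use that in auto)
  define d where "d = e * ln 2 / D"
  have "d > 0" using \<open>e > 0\<close> D(1) by (simp add: d_def)
  from unif[OF this] eventually_ge_at_top[of a]
  show "\<forall>\<^sub>F t in at_top. norm (g t - (1 / ln 2) *\<^sub>R (matrix_powr t B *v integral {t..2*t} K)) \<le> e * \<bar>g t $ ?n\<bar>"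
  proof eventually_elim
    case (elim t)
    let ?h = "\<lambda>w. matrix_powr t B *v w"
    have t: "t > 0" using elim(2) \<open>a > 0\<close> by simp
    have "K integrable_on {t..2*t}"
      by (rule integrable_on_subinterval[OF int[of "2 * t"]]) (use elim(2) t in auto)
    then have "(K has_integral integral {t..2*t} K) {t..2*t}" by (rule integrable_integral)
    from has_integral_linear[OF this, of ?h]
    have 1: "((\<lambda>u. ?h (K u)) has_integral ?h (integral {t..2*t} K)) {t..2*t}"
      by (simp add: o_def)
    \<comment> \<open>Writes \<open>ln 2 *\<^sub>R g t\<close> as an integral over the same
      interval, so that the error becomes the integral of a difference.\<close>
    have "((\<lambda>u. inverse u *\<^sub>R g t) has_integral ln (2 * t) *\<^sub>R g t - ln t *\<^sub>R g t) {t..2*t}"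
      using t by (intro fundamental_theorem_of_calculus)
        (auto intro!: derivative_eq_intros simp flip: has_real_derivative_iff_has_vector_derivative
          simp: divide_inverse)
    then have 2: "((\<lambda>u. inverse u *\<^sub>R g t) has_integral ln 2 *\<^sub>R g t) {t..2*t}"
      using t by (simp add: ln_mult scaleR_left_distrib)
    let ?F = "\<lambda>u. ?h (K u) - inverse u *\<^sub>R g t"
    have F: "(?F has_integral ?h (integral {t..2*t} K) - ln 2 *\<^sub>R g t) {t..2*t}"
      by (rule has_integral_diff[OF 1 2])
    have "norm (integral {t..2*t} ?F) \<le> inverse t * (D * (d * \<bar>g t $ ?n\<bar>)) * (2 * t - t)"
    proof (rule norm_integral_le_const)
      show "?F integrable_on {t..2*t}" using F by (rule has_integral_integrable)
      fix u assume u: "u \<in> {t..2*t}"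
      then have u0: "u > 0" and q: "1/2 \<le> t / u" "t / u \<le> 1" "u / t \<in> {1..2}"
        using t by (auto simp: divide_simps)
      let ?E = "g u - matrix_powr (u / t) B *v g t"
      have "?F u = inverse u *\<^sub>R (matrix_powr (t / u) B *v ?E)"
      proof -
        have "?h (K u) = inverse u *\<^sub>R (matrix_powr (t / u) B *v g u)"
          using u0 t
          by (simp add: K_def matrix_powr_uminus matrix_vector_mult_scaleR matrix_powr_mult_vec divide_inverse)
        moreover have "matrix_powr (t / u) B *v (matrix_powr (u / t) B *v g t) = g t"
          using u0 t by (simp add: matrix_powr_mult_vec matrix_powr_one)
        ultimately show ?thesis
          by (simp add: matrix_vector_mult_diff_distrib scaleR_diff_right)
      qed
      then have "norm (?F u) = inverse u * norm (matrix_powr (t / u) B *v ?E)"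
        using u0 by simp
      also have "\<dots> \<le> inverse t * (D * (d * \<bar>g t $ ?n\<bar>))"
      proof (intro mult_mono le_imp_inverse_le)
        have "norm ?E \<le> d * \<bar>g t $ ?n\<bar>" using elim(1)[rule_format, OF q(3)] t by simp
        then show "norm (matrix_powr (t / u) B *v ?E) \<le> D * (d * \<bar>g t $ ?n\<bar>)"
          using D(1) by (intro order_trans[OF D(2)[OF q(1,2)]] mult_left_mono) auto
      qed (use t u in auto)
      finally show "norm (?F u) \<le> inverse t * (D * (d * \<bar>g t $ ?n\<bar>))" .
    qed (use t in simp)
    also have "\<dots> = ln 2 * (e * \<bar>g t $ ?n\<bar>)" using t D(1) by (simp add: d_def)
    also have "integral {t..2*t} ?F = - (ln 2 *\<^sub>R (g t - (1 / ln 2) *\<^sub>R ?h (integral {t..2*t} K)))"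
      using integral_unique[OF F] by (simp add: scaleR_diff_right)
    finally show ?case by simp
  qed
qed

lemma regularly_varying_imp_representation:
  fixes g :: "real \<Rightarrow> real ^ ('n::{finite,linorder})"
    and B :: "real ^ ('n::{finite,linorder}) ^ ('n::{finite,linorder})"
  assumes meas: "g \<in> borel_measurable (lebesgue_on {t\<^sub>0..})"
    and upper: "\<And>i j. j < i \<Longrightarrow> B $ i $ j = 0"
    and nz: "\<forall>\<^sub>F t in at_top. g t $ last_index \<noteq> 0"
    and lim: "\<And>x. x > 0 \<Longrightarrow> small_o_last (\<lambda>t. g (x * t) - matrix_powr x B *v g t) g"
  obtains a \<eta> \<phi> v where "a > 0"
    "\<eta> \<in> borel_measurable (lebesgue_on {a..})" "\<phi> \<in> borel_measurable (lebesgue_on {a..})"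
    "small_o_last \<eta> g" "small_o_last \<phi> g"
    "\<And>t. t \<ge> a \<Longrightarrow>
       (\<lambda>u. inverse u *\<^sub>R (matrix_powr u (- B) *v \<phi> u)) absolutely_integrable_on {a..t}"
    "\<And>t. t \<ge> a \<Longrightarrow> g t = matrix_powr t B *v v + \<eta> t +
       matrix_powr t B *v integral {a..t} (\<lambda>u. inverse u *\<^sub>R (matrix_powr u (- B) *v \<phi> u))"
proof -
  let ?n = "last_index :: 'n::{finite,linorder}"
  \<comment> \<open>Extension by zero gives a function measurable on the whole line, as the uniform
    convergence lemma requires.\<close>
  define g0 where "g0 = (\<lambda>t. if t \<in> {t\<^sub>0..} then g t else 0)"
  have g0_meas: "g0 \<in> borel_measurable lebesgue"
    unfolding g0_def using meas by (subst borel_measurable_if) auto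
  have g0: "\<forall>\<^sub>F t in at_top. g0 (x * t) = g (x * t)" if "x > 0" for x
  proof -
    have "\<forall>\<^sub>F t in at_top. t \<ge> t\<^sub>0 / x" by (rule eventually_ge_at_top)
    then show ?thesis
      by eventually_elim (use that in \<open>simp add: g0_def divide_simps mult.commute\<close>)
  qed
  have unif: "\<forall>\<^sub>F t in at_top. \<forall>x\<in>{1..2}.
      norm (g (x * t) - matrix_powr x B *v g t) \<le> e * \<bar>g t $ ?n\<bar>" if "e > 0" for e
  proof -
    have "\<forall>\<^sub>F t in at_top. \<forall>x\<in>{1..2}.
      norm (g0 (x * t) - matrix_powr x B *v g0 t) \<le> e * \<bar>g0 t $ ?n\<bar>"
    proof (rule uniform_convergence[OF g0_meas upper _ _ \<open>e > 0\<close>])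
      show "\<forall>\<^sub>F t in at_top. g0 t $ ?n \<noteq> 0"
        using nz g0[of 1, simplified] by eventually_elim simp
      show "small_o_last (\<lambda>t. g0 (x * t) - matrix_powr x B *v g0 t) g0" if "x > 0" for x
        unfolding small_o_last_iff
      proof (intro allI impI)
        fix e :: real assume "e > 0"
        with lim[OF \<open>x > 0\<close>]
        have "\<forall>\<^sub>F t in at_top. norm (g (x * t) - matrix_powr x B *v g t) \<le> e * \<bar>g t $ ?n\<bar>"
          unfolding small_o_last_iff by blast
        with g0[OF \<open>x > 0\<close>] g0[of 1, simplified]
        show "\<forall>\<^sub>F t in at_top. norm (g0 (x * t) - matrix_powr x B *v g0 t) \<le> e * \<bar>g0 t $ ?n\<bar>"
          by eventually_elim simp
      qed
    qed
    with eventually_ge_at_top[of "max 0 t\<^sub>0"] show ?thesis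
    proof eventually_elim
      case (elim t)
      have "x * t \<ge> t\<^sub>0" if "x \<in> {1..2}" for x
        using elim(1) that mult_right_mono[of 1 x t] by auto
      with elim show ?case by (simp add: g0_def)
    qed
  qed
  obtain T where T: "\<And>t x. t \<ge> T \<Longrightarrow> x \<in> {1..2} \<Longrightarrow>
      norm (g (x * t) - matrix_powr x B *v g t) \<le> \<bar>g t $ ?n\<bar>"
    using unif[OF zero_less_one] unfolding eventually_at_top_linorder mult_1 by blast
  \<comment> \<open>From \<open>a\<close> on, \<open>g\<close> is measurable and the uniform
    estimate with constant 1 holds, hence also local boundedness.\<close>
  define a where "a = max 1 (max t\<^sub>0 T)"
  have a: "a > 0" "a \<ge> t\<^sub>0" "a \<ge> T" by (auto simp: a_def)
  define \<phi> where "\<phi> = (\<lambda>r. (1 / ln 2) *\<^sub>R (matrix_powr (1/2) B *v g (2 * r) - g r))"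
  define K where "K = (\<lambda>u. inverse u *\<^sub>R (matrix_powr u (- B) *v g u))"
  define \<eta> where "\<eta> = (\<lambda>t. g t - (1 / ln 2) *\<^sub>R (matrix_powr t B *v integral {t..2*t} K))"
  define v where "v = (1 / ln 2) *\<^sub>R integral {a..2*a} K"
  let ?K\<phi> = "\<lambda>u. inverse u *\<^sub>R (matrix_powr u (- B) *v \<phi> u)"

  have ga: "g \<in> borel_measurable (lebesgue_on {a..})"
    by (rule measurable_restrict_mono[OF meas]) (use a in auto)
  have "(\<lambda>r. g0 (2 * r)) \<in> borel_measurable (lebesgue_on {a..})"
    using measurable_comp[OF lebesgue_measurable_scaling g0_meas, of 2]
    by (intro measurable_restrict_space1) (simp add: o_def)
  then have g2: "(\<lambda>r. g (2 * r)) \<in> borel_measurable (lebesgue_on {a..})"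
    by (rule measurable_cong[THEN iffD1, rotated]) (use a in \<open>auto simp: g0_def\<close>)
  have "(\<lambda>w. matrix_powr (1/2) B *v w) \<in> borel_measurable borel"
    by (intro borel_measurable_continuous_onI linear_continuous_on) simp
  from measurable_compose[OF g2 this]
  have \<phi>_meas: "\<phi> \<in> borel_measurable (lebesgue_on {a..})"
    unfolding \<phi>_def
    by (intro borel_measurable_scaleR borel_measurable_diff ga borel_measurable_const)

  have gb: "\<exists>c. \<forall>t\<in>{a..M}. norm (g t) \<le> c" for M
    by (rule uniform_shift_imp_locally_bounded[where B = B]) (use a T in auto)
  have K_int: "K integrable_on {a..t}" for t
  proof -
    obtain c where "\<And>u. u \<in> {a..t} \<Longrightarrow> norm (g u) \<le> c" using gb by blast
    from absolutely_integrable_matrix_powr[OF ga a(1) this] show ?thesis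
      unfolding K_def by (rule set_lebesgue_integral_eq_integral(1))
  qed
  \<comment> \<open>The right-hand side is the formal derivative in \<open>r\<close> of the mean of
    \<open>K\<close> over the interval from \<open>r\<close> to \<open>2 * r\<close>; \<phi> was
    chosen to produce it.\<close>
  have K\<phi>: "?K\<phi> r = (1 / ln 2) *\<^sub>R (2 *\<^sub>R K (2 * r) - K r)" if "r > 0" for r
    using that
    by (simp add: K_def \<phi>_def matrix_powr_uminus matrix_vector_mult_scaleR matrix_powr_mult_vec
        matrix_vector_mult_diff_distrib scaleR_diff_right inverse_eq_divide mult.commute)
  have int_K\<phi>: "integral {a..t} ?K\<phi> = (1 / ln 2) *\<^sub>R (integral {t..2*t} K - integral {a..2*a} K)"
    if "t \<ge> a" for t
  proof -
    have 2: "2 * a \<le> 2 * t" "a \<le> 2 * a" "t \<le> 2 * t" "a \<le> 2 * t" using that a(1) by auto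
    have Ki: "K integrable_on {2*a..2*t}"
      by (rule integrable_on_subinterval[OF K_int[of "2 * t"]]) (use a(1) in auto)
    \<comment> \<open>In the substitution of \<open>2 * r\<close> for \<open>r\<close>, the
      resulting factor 1/2 cancels the 2 before \<open>K (2 * r)\<close>.\<close>
    have "(\<lambda>x. x / 2) ` {2*a..2*t} = {a..t}"
      using that by simp
    with has_integral_stretch_real[OF integrable_integral[OF Ki], of 2]
    have "((\<lambda>r. K (2 * r)) has_integral (1/2) *\<^sub>R integral {2*a..2*t} K) {a..t}" by simp
    from has_integral_cmul[OF this, of 2]
    have "((\<lambda>r. 2 *\<^sub>R K (2 * r)) has_integral integral {2*a..2*t} K) {a..t}" by simp
    from has_integral_cmul[OF has_integral_diff[OF this integrable_integral[OF K_int]], of "1 / ln 2"]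
    have "((\<lambda>r. (1 / ln 2) *\<^sub>R (2 *\<^sub>R K (2 * r) - K r)) has_integral
        (1 / ln 2) *\<^sub>R (integral {2*a..2*t} K - integral {a..t} K)) {a..t}" .
    then have "(?K\<phi> has_integral (1 / ln 2) *\<^sub>R (integral {2*a..2*t} K - integral {a..t} K)) {a..t}"
      by (rule has_integral_eq[rotated]) (rule K\<phi>[symmetric], use a(1) in simp)
    then have "integral {a..t} ?K\<phi> = (1 / ln 2) *\<^sub>R (integral {2*a..2*t} K - integral {a..t} K)"
      by (rule integral_unique)
    \<comment> \<open>Measuring all integrals from \<open>a\<close> avoids a case distinction on the
      order of \<open>t\<close> and \<open>2 * a\<close>.\<close>
    moreover have "integral {2*a..2*t} K = integral {a..2*t} K - integral {a..2*a} K"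
      by (simp flip: Henstock_Kurzweil_Integration.integral_combine[OF 2(2,1) K_int])
    moreover have "integral {t..2*t} K = integral {a..2*t} K - integral {a..t} K"
      by (simp flip: Henstock_Kurzweil_Integration.integral_combine[OF that 2(3) K_int])
    moreover have "integral {a..2*t} K - integral {a..2*a} K - integral {a..t} K
        = integral {a..2*t} K - integral {a..t} K - integral {a..2*a} K"
      by (simp add: algebra_simps)
    ultimately show ?thesis by (simp only:)
  qed

  show thesis
  proof (rule that[of a \<eta> \<phi> v])
    show "a > 0" by (rule a(1))
    show "\<phi> \<in> borel_measurable (lebesgue_on {a..})" by (rule \<phi>_meas)
    have eq: "integral {t..2*t} K = integral {a..2*t} K - integral {a..t} K" if "t \<in> {a..}" for t
    proof -
      have "a \<le> t" "t \<le> 2 * t" using that a(1) by auto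
      from Henstock_Kurzweil_Integration.integral_combine[OF this K_int] show ?thesis
        by (simp add: eq_diff_eq add.commute)
    qed
    have cont: "continuous_on {a..} (\<lambda>t. integral {a..t} K)"
      by (rule continuous_on_indefinite_integral_atLeast[OF K_int])
    from this have cont2: "continuous_on {a..} (\<lambda>t. integral {a..2*t} K)"
      by (rule continuous_on_compose2[where f = "\<lambda>t. 2 * t"])
         (intro continuous_intros, use a(1) in auto)
    have "continuous_on {a..} (\<lambda>t. integral {t..2*t} K)"
      by (rule continuous_on_eq[OF continuous_on_diff[OF cont2 cont]]) (rule eq[symmetric])
    then have "continuous_on {a..} (\<lambda>t. matrix_powr t B *v integral {t..2*t} K)"
      using a(1) by (intro continuous_on_matrix_powr) auto
    then have "(\<lambda>t. matrix_powr t B *v integral {t..2*t} K) \<in> borel_measurable (lebesgue_on {a..})"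
      by (rule continuous_imp_measurable_on_sets_lebesgue) simp
    with ga show "\<eta> \<in> borel_measurable (lebesgue_on {a..})"
      unfolding \<eta>_def by (intro borel_measurable_diff borel_measurable_scaleR borel_measurable_const)
    show "small_o_last \<eta> g"
      unfolding \<eta>_def K_def using a(1) K_int[unfolded K_def] unif
      by (rule small_o_last_average_error)
    show "small_o_last \<phi> g"
      unfolding small_o_last_iff
    proof (intro allI impI)
      fix e :: real assume "e > 0"
      obtain D where D: "D > 0" "\<And>w. norm (matrix_powr (1/2) B *v w) \<le> D * norm w"
        by (rule matrix_powr_bounded[of "1/2" "1/2" B]) (use that in auto)
      define d where "d = e * ln 2 / D"
      have "d > 0" using \<open>e > 0\<close> D(1) by (simp add: d_def)
      with lim[of 2] have "\<forall>\<^sub>F t in at_top. norm (g (2 * t) - matrix_powr 2 B *v g t) \<le> d * \<bar>g t $ ?n\<bar>"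
        unfolding small_o_last_iff by simp
      then show "\<forall>\<^sub>F t in at_top. norm (\<phi> t) \<le> e * \<bar>g t $ ?n\<bar>"
      proof eventually_elim
        case (elim t)
        \<comment> \<open>Since the powers of 1/2 and 2 cancel, \<phi> is a fixed linear image of
          the error at ratio 2.\<close>
        have "\<phi> t = (1 / ln 2) *\<^sub>R (matrix_powr (1/2) B *v (g (2 * t) - matrix_powr 2 B *v g t))"
          by (simp add: \<phi>_def matrix_vector_mult_diff_distrib matrix_powr_mult_vec matrix_powr_one)
        then have "norm (\<phi> t) = 1 / ln 2 * norm (matrix_powr (1/2) B *v (g (2 * t) - matrix_powr 2 B *v g t))"
          by simp
        also have "\<dots> \<le> 1 / ln 2 * (D * (d * \<bar>g t $ ?n\<bar>))"
          using D(1) elim by (intro mult_left_mono order_trans[OF D(2)]) auto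
        also have "\<dots> = e * \<bar>g t $ ?n\<bar>" using D(1) by (simp add: d_def)
        finally show ?case .
      qed
    qed
    show "?K\<phi> absolutely_integrable_on {a..t}" if "t \<ge> a" for t
    proof -
      \<comment> \<open>The bound reaches up to \<open>2 * t\<close> because \<phi> evaluates
        \<open>g\<close> at twice its argument.\<close>
      obtain c where c: "\<And>u. u \<in> {a..2*t} \<Longrightarrow> norm (g u) \<le> c" using gb by blast
      obtain D where D: "D > 0" "\<And>w. norm (matrix_powr (1/2) B *v w) \<le> D * norm w"
        by (rule matrix_powr_bounded[of "1/2" "1/2" B]) (use that in auto)
      show ?thesis
      proof (rule absolutely_integrable_matrix_powr[OF \<phi>_meas a(1)])
        fix u assume u: "u \<in> {a..t}"
        have "norm (matrix_powr (1/2) B *v g (2 * u) - g u) \<le> D * c + c"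
          using u a(1) D(1)
          by (intro order_trans[OF norm_triangle_ineq4] add_mono order_trans[OF D(2)] mult_left_mono c) auto
        then show "norm (\<phi> u) \<le> 1 / ln 2 * (D * c + c)"
          by (simp add: \<phi>_def divide_right_mono)
      qed
    qed
    show "g t = matrix_powr t B *v v + \<eta> t + matrix_powr t B *v integral {a..t} ?K\<phi>" if "t \<ge> a" for t
      unfolding int_K\<phi>[OF that]
      by (simp add: v_def \<eta>_def matrix_vector_mult_scaleR matrix_vector_mult_diff_distrib scaleR_diff_right)
  qed
qed

section \<open>Both directions, with absolute integrability identifying Lebesgue and gauge
  integrals\<close>

theorem theorem4p3:
  fixes g :: "real \<Rightarrow> real ^ ('n::{finite,linorder})"
    and B :: "real ^ ('n::{finite,linorder}) ^ ('n::{finite,linorder})"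
  assumes "rate_vector g"
    and "index_matrix B"
  shows "g \<in> regularly_varying B \<longleftrightarrow>
    (\<exists>(a::real) (v :: real ^ ('n::{finite,linorder})) (\<eta> :: real \<Rightarrow> real ^ ('n::{finite,linorder})) (\<phi> :: real \<Rightarrow> real ^ ('n::{finite,linorder})).
       a > 0 \<and>
       \<eta> \<in> borel_measurable (lebesgue_on {a..}) \<and>
       \<phi> \<in> borel_measurable (lebesgue_on {a..}) \<and>
       small_o_last \<eta> g \<and> small_o_last \<phi> g \<and>
       (\<forall>t\<ge>a. set_integrable lebesgue {a..t} (\<lambda>u. inverse u *\<^sub>R (matrix_powr u (- B) *v \<phi> u))) \<and>
       (\<forall>t\<ge>a. g t = matrix_powr t B *v v + \<eta> t +
          matrix_powr t B *v
            (LINT u:{a..t}|lebesgue. inverse u *\<^sub>R (matrix_powr u (- B) *v \<phi> u))))"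
    (is "?L \<longleftrightarrow> ?R")
proof
  have upper: "B $ i $ j = 0" if "j < i" for i j
    using \<open>index_matrix B\<close> that unfolding index_matrix_def by blast
  show ?R if ?L
  proof -
    from that obtain t\<^sub>0 where meas: "g \<in> borel_measurable (lebesgue_on {t\<^sub>0..})"
      and lim: "\<And>x. x > 0 \<Longrightarrow> small_o_last (\<lambda>t. g (x * t) - matrix_powr x B *v g t) g"
      unfolding regularly_varying_def by blast
    obtain a \<eta> \<phi> v where rep: "a > 0"
      "\<eta> \<in> borel_measurable (lebesgue_on {a..})" "\<phi> \<in> borel_measurable (lebesgue_on {a..})"
      "small_o_last \<eta> g" "small_o_last \<phi> g"
      "\<And>t. t \<ge> a \<Longrightarrow>
         (\<lambda>u. inverse u *\<^sub>R (matrix_powr u (- B) *v \<phi> u)) absolutely_integrable_on {a..t}"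
      "\<And>t. t \<ge> a \<Longrightarrow> g t = matrix_powr t B *v v + \<eta> t +
         matrix_powr t B *v integral {a..t} (\<lambda>u. inverse u *\<^sub>R (matrix_powr u (- B) *v \<phi> u))"
      by (rule regularly_varying_imp_representation[OF meas upper
            rate_vector_eventually_nonzero[OF \<open>rate_vector g\<close>] lim]) (assumption | rule that)+
    show ?R
    proof (intro exI conjI allI impI)
      fix t assume "t \<ge> a"
      show "g t = matrix_powr t B *v v + \<eta> t + matrix_powr t B *v
          (LINT u:{a..t}|lebesgue. inverse u *\<^sub>R (matrix_powr u (- B) *v \<phi> u))"
        unfolding set_lebesgue_integral_eq_integral(2)[OF rep(6)[OF \<open>t \<ge> a\<close>]]
        by (rule rep(7)[OF \<open>t \<ge> a\<close>])
    qed (rule rep(1-5) | erule rep(6))+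
  qed
  show ?L if ?R
  proof -
    from that obtain a v \<eta> \<phi> where "a > 0" and \<eta>: "\<eta> \<in> borel_measurable (lebesgue_on {a..})"
      and small: "small_o_last \<eta> g" "small_o_last \<phi> g"
      and ai: "\<And>t. t \<ge> a \<Longrightarrow>
         (\<lambda>u. inverse u *\<^sub>R (matrix_powr u (- B) *v \<phi> u)) absolutely_integrable_on {a..t}"
      and rep0: "\<And>t. t \<ge> a \<Longrightarrow> g t = matrix_powr t B *v v + \<eta> t + matrix_powr t B *v
         (LINT u:{a..t}|lebesgue. inverse u *\<^sub>R (matrix_powr u (- B) *v \<phi> u))"
      by blast
    let ?K = "\<lambda>u. inverse u *\<^sub>R (matrix_powr u (- B) *v \<phi> u)"
    have int: "?K integrable_on {a..t}" if "t \<ge> a" for t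
      by (rule set_lebesgue_integral_eq_integral(1)[OF ai[OF that]])
    have rep: "g t = matrix_powr t B *v v + \<eta> t + matrix_powr t B *v integral {a..t} ?K" if "t \<ge> a" for t
      using rep0[OF that] unfolding set_lebesgue_integral_eq_integral(2)[OF ai[OF that]] .
    \<comment> \<open>Measurability of \<open>g\<close> is read off the representation: \<eta> is
      measurable and the other two terms are continuous.\<close>
    have "continuous_on {a..} (\<lambda>t. matrix_powr t B *v v)"
      "continuous_on {a..} (\<lambda>t. matrix_powr t B *v integral {a..t} ?K)"
      using \<open>a > 0\<close>
      by (intro continuous_on_matrix_powr continuous_on_id continuous_on_const
          continuous_on_indefinite_integral_atLeast int; simp)+
    then have "(\<lambda>t. matrix_powr t B *v v + \<eta> t + matrix_powr t B *v integral {a..t} ?K)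
        \<in> borel_measurable (lebesgue_on {a..})"
      by (intro borel_measurable_add \<eta> continuous_imp_measurable_on_sets_lebesgue) auto
    then have "g \<in> borel_measurable (lebesgue_on {a..})"
      by (rule measurable_cong[THEN iffD1, rotated]) (simp add: rep)
    moreover have ge1: "small_o_last (\<lambda>t. g (x * t) - matrix_powr x B *v g t) g" if "x \<ge> 1" for x
      by (rule representation_shift_ge_1[OF upper \<open>a > 0\<close> small int rep that])
    have "small_o_last (\<lambda>t. g (x * t) - matrix_powr x B *v g t) g" if "x > 0" for x
    proof (cases "x \<ge> 1")
      case False
      then have "inverse x \<ge> 1" using that by (simp add: one_le_inverse)
      from small_o_last_shift_inverse[OF upper that ge1[OF this]] show ?thesis .
    qed (rule ge1)
    ultimately show ?L
      using \<open>rate_vector g\<close> unfolding regularly_varying_def by blast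
  qed
qed

end
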